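(* Let $G$ be a connected 4-regular graph and let $p$ be any prime. Let $v$ and $w$ be adjacent vertices of $G$ which have exactly two common neighbours. Then \[ c_2^{(p)}(G - v) = c_2^{(p)}(G - w), \] and thus $c_2(G - v) = c_2(G - w)$.
   Context: For a graph $H$, $H-v$ denotes the graph obtained by deleting the vertex $v$ and all edges incident to it. For a connected graph $H$ with at least $3$ vertices, assign a variable $\alpha_e$ to each edge $e$ and define the Kirchhoff polynomial $\Psi_H=\sum_{T}\prod_{e\notin T}\alpha_e$, the sum over all spanning trees $T$ of $H$. For a prime $p$, let $[\Psi_H]_p$ be the number of zeros of $\Psi_H$ in $\mathbb{F}_p^{|E(H)|}$; it is divisible by $p^2$, and $c_2^{(p)}(H)\equiv [\Psi_H]_p/p^2 \pmod p$, an element of $\mathbb{Z}/p\mathbb{Z}$. The $c_2$-invariant $c_2(H)$ denotes the sequence $(c_2^{(p)}(H))_p$ indexed by all primes $p$. *)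

theory Defs
  imports "HOL-Library.FuncSet" "HOL-Number_Theory.Cong"
begin

text \<open>
  Undirected multigraphs. Edges are abstract labels, so parallel edges are distinct elements
  of \<open>edges G\<close>; a loop at \<open>x\<close> is an edge \<open>e\<close> with \<open>ends G e = {x}\<close>.
\<close>

record ('v, 'e) multigraph =
  verts :: "'v set"
  edges :: "'e set"
  ends :: "'e \<Rightarrow> 'v set"

definition wf_graph :: "('v, 'e) multigraph \<Rightarrow> bool" where
  "wf_graph G \<longleftrightarrow> finite (verts G) \<and> finite (edges G) \<and>
     (\<forall>e\<in>edges G. \<exists>x\<in>verts G. \<exists>y\<in>verts G. ends G e = {x, y})"

text \<open>
  A walk from \<open>u\<close> is the list of its steps \<open>(e, x)\<close>: traverse the edge \<open>e\<close> and arrive at \<open>x\<close>.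
\<close>

fun walk :: "('v, 'e) multigraph \<Rightarrow> 'v \<Rightarrow> ('e \<times> 'v) list \<Rightarrow> 'v \<Rightarrow> bool" where
  "walk G u [] w \<longleftrightarrow> u \<in> verts G \<and> u = w"
| "walk G u ((e, x) # s) w \<longleftrightarrow>
     u \<in> verts G \<and> e \<in> edges G \<and> ends G e = {u, x} \<and> walk G x s w"

definition connected_graph :: "('v, 'e) multigraph \<Rightarrow> bool" where
  "connected_graph G \<longleftrightarrow> verts G \<noteq> {} \<and> (\<forall>u\<in>verts G. \<forall>w\<in>verts G. \<exists>s. walk G u s w)"

text \<open>
  A loop is a cycle of length 1 and a pair of parallel edges gives a cycle of length 2;
  distinctness of the edges rules out walking back and forth along one edge.
\<close>

definition is_cycle :: "('v, 'e) multigraph \<Rightarrow> 'v \<Rightarrow> ('e \<times> 'v) list \<Rightarrow> bool" where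
  "is_cycle G u s \<longleftrightarrow> s \<noteq> [] \<and> walk G u s u \<and> distinct (map fst s) \<and> distinct (map snd s)"

definition is_tree :: "('v, 'e) multigraph \<Rightarrow> bool" where
  "is_tree G \<longleftrightarrow> connected_graph G \<and> (\<nexists>u s. is_cycle G u s)"

definition spanning_trees :: "('v, 'e) multigraph \<Rightarrow> 'e set set" where
  "spanning_trees G = {T. T \<subseteq> edges G \<and> is_tree (G\<lparr>edges := T\<rparr>)}"

text \<open>A loop contributes 2 to the degree of its vertex.\<close>

definition degree :: "('v, 'e) multigraph \<Rightarrow> 'v \<Rightarrow> nat" where
  "degree G u = card {e \<in> edges G. u \<in> ends G e} + card {e \<in> edges G. ends G e = {u}}"

definition regular_graph :: "nat \<Rightarrow> ('v, 'e) multigraph \<Rightarrow> bool" where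
  "regular_graph d G \<longleftrightarrow> (\<forall>u\<in>verts G. degree G u = d)"

definition neighbours :: "('v, 'e) multigraph \<Rightarrow> 'v \<Rightarrow> 'v set" where
  "neighbours G u = {x. x \<noteq> u \<and> (\<exists>e\<in>edges G. ends G e = {u, x})}"

definition delete_vertex :: "('v, 'e) multigraph \<Rightarrow> 'v \<Rightarrow> ('v, 'e) multigraph" where
  "delete_vertex G v = G\<lparr>verts := verts G - {v}, edges := {e \<in> edges G. v \<notin> ends G e}\<rparr>"

text \<open>The Kirchhoff polynomial, as a polynomial function of the edge variables.\<close>

definition kirchhoff :: "('v, 'e) multigraph \<Rightarrow> ('e \<Rightarrow> 'a::comm_ring_1) \<Rightarrow> 'a" where
  "kirchhoff G \<alpha> = (\<Sum>T\<in>spanning_trees G. \<Prod>e\<in>edges G - T. \<alpha> e)"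

text \<open>
  The field with \<open>p\<close> elements is represented by the residues \<open>{0..<p}\<close>, and vanishing in it
  by congruence to 0 modulo \<open>p\<close>.
\<close>

definition point_count :: "nat \<Rightarrow> ('v, 'e) multigraph \<Rightarrow> nat" where
  "point_count p G =
     card {\<alpha> \<in> edges G \<rightarrow>\<^sub>E {0..<int p}. [kirchhoff G \<alpha> = 0] (mod int p)}"

text \<open>
  The element of the ring of integers modulo \<open>p\<close> is given by its representative in \<open>{0..<p}\<close>.
  For connected graphs with at least 3 vertices the division by \<open>p\<^sup>2\<close> is exact; the value is
  meaningful only for such graphs.
\<close>

definition c2_at :: "nat \<Rightarrow> ('v, 'e) multigraph \<Rightarrow> nat" where
  "c2_at p G = (point_count p G div p\<^sup>2) mod p"

definition c2 :: "('v, 'e) multigraph \<Rightarrow> nat \<Rightarrow> nat" where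
  "c2 G = (\<lambda>p\<in>{p. prime p}. c2_at p G)"

end

theory Submission
  imports Defs Complex_Main
begin

text \<open>
  Let \<open>K = G - v - w\<close>, let \<open>a, b\<close> be the common neighbours and let \<open>y\<close> be the fourth neighbour of
  \<open>w\<close>, so that \<open>G - v\<close> is \<open>K\<close> with a vertex joined to \<open>a, b, y\<close>. With \<open>T\<close> the tree sum of \<open>K\<close>,
  \<open>f\<^sub>1\<^sub>3, f\<^sub>2\<^sub>3\<close> the sums over 2-forests separating \<open>a\<close> from \<open>y\<close> and \<open>b\<close> from \<open>y\<close>, \<open>f\<^sub>3\<close> the sum
  over 2-forests separating both \<open>a\<close> and \<open>b\<close> from \<open>y\<close>, and \<open>F\<close> the sum over 3-forests separating
  \<open>a, b, y\<close>, one has \<open>T F = f\<^sub>1\<^sub>3 f\<^sub>2\<^sub>3 - f\<^sub>3\<^sup>2\<close>. Hence the Kirchhoff polynomial is, in the three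
  variables at \<open>w\<close>, a nondegenerate quadratic cone or a linear form, with exactly \<open>p\<^sup>2\<close> zeros, unless
  \<open>T = f\<^sub>1\<^sub>3 = f\<^sub>2\<^sub>3 = 0\<close>. So the invariant is, modulo \<open>p\<close>, a constant minus the number of common zeros
  of \<open>T, f\<^sub>1\<^sub>3, f\<^sub>2\<^sub>3\<close>, and it has to be shown that this number does not depend on \<open>y\<close>.

  By the identity and inclusion-exclusion it equals \<open>[T, f\<^sub>1\<^sub>3] + [T, f\<^sub>2\<^sub>3] - [T, f\<^sub>3]\<close>. Since \<open>a\<close> and
  \<open>b\<close> have degree 2 in \<open>K\<close>, the first two terms vanish modulo \<open>p\<close>: the polynomials depend only on
  the sum of the two variables at \<open>b\<close>, respectively at \<open>a\<close>. In the last term the variables at \<open>a\<close>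
  and \<open>b\<close> enter linearly and can be eliminated one vertex at a time; what remains counts the
  points where neither the tree sum of \<open>K - a - b\<close> nor a signed 2-forest sum not involving \<open>y\<close>
  vanishes. Loops, double edges and an edge between \<open>a\<close> and \<open>b\<close> are degenerate variants.
\<close>

section \<open>Connectivity and forests\<close>

text \<open>Only the edge set enters. A vertex without edges is still connected to itself, and no
  vertex set has to be carried along.\<close>

definition conn :: "('e \<Rightarrow> 'v set) \<Rightarrow> 'e set \<Rightarrow> 'v \<Rightarrow> 'v \<Rightarrow> bool" where
  "conn g F u v \<longleftrightarrow> (u, v) \<in> {(x, y). \<exists>e\<in>F. g e = {x, y}}\<^sup>*"

text \<open>Acyclicity in the form that every edge is a bridge, so that adding and deleting edges
  becomes a question about \<open>conn\<close> alone. Loops are excluded because \<open>conn\<close>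
  is reflexive.\<close>

definition forest :: "('e \<Rightarrow> 'v set) \<Rightarrow> 'e set \<Rightarrow> bool" where
  "forest g F \<longleftrightarrow> (\<forall>e\<in>F. \<forall>u z. g e = {u, z} \<longrightarrow> \<not> conn g (F - {e}) u z)"

text \<open>One root gives the spanning trees, more roots the spanning forests that separate them.
  Since \<open>conn\<close> is reflexive, \<open>sorted_wrt\<close> also rules out a repeated root;
  an empty list of roots forces \<open>V\<close> to be empty. A list makes it easy to prepend a
  root, as in \<open>rooted_forest_cut\<close>.\<close>

definition rooted_forest :: "('e \<Rightarrow> 'v set) \<Rightarrow> 'v set \<Rightarrow> 'v list \<Rightarrow> 'e set \<Rightarrow> bool" where
  "rooted_forest g V rs F \<longleftrightarrow> forest g F \<and> sorted_wrt (\<lambda>r s. \<not> conn g F r s) rs \<and>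
     (\<forall>z\<in>V. \<exists>r\<in>set rs. conn g F r z)"

lemma conn_refl [simp]: "conn g F u u"
  by (simp add: conn_def)

lemma conn_trans [trans]: "conn g F u v \<Longrightarrow> conn g F v w \<Longrightarrow> conn g F u w"
  unfolding conn_def by (rule rtrancl_trans)

lemma conn_sym: "conn g F u v \<Longrightarrow> conn g F v u"
proof -
  have "sym {(x, y). \<exists>e\<in>F. g e = {x, y}}"
    by (auto simp: sym_def insert_commute)
  then show "conn g F u v \<Longrightarrow> conn g F v u"
    unfolding conn_def by (meson sym_rtrancl symD)
qed

lemma conn_commute: "conn g F u v \<longleftrightarrow> conn g F v u"
  using conn_sym by metis

lemma conn_edge: "e \<in> F \<Longrightarrow> g e = {u, v} \<Longrightarrow> conn g F u v"
  unfolding conn_def by (rule r_into_rtrancl) auto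

lemma conn_mono: "conn g F u v \<Longrightarrow> F \<subseteq> F' \<Longrightarrow> conn g F' u v"
  unfolding conn_def by (erule rtrancl_mono[THEN subsetD, rotated]) auto

lemma conn_induct [consumes 1, case_names refl step]:
  assumes "conn g F u v"
    and "P u"
    and "\<And>x y e. conn g F u x \<Longrightarrow> P x \<Longrightarrow> e \<in> F \<Longrightarrow> g e = {x, y} \<Longrightarrow> P y"
  shows "P v"
  using assms(1) unfolding conn_def
  by (induction rule: rtrancl_induct) (auto intro: assms(2,3) simp: conn_def)

text \<open>A connection needs the new edge at most once, in one of its two directions.\<close>

lemma conn_insert:
  assumes "g e = {u, z}"
  shows "conn g (insert e F) s t \<longleftrightarrow>
    conn g F s t \<or> conn g F s u \<and> conn g F z t \<or> conn g F s z \<and> conn g F u t"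
proof
  assume "conn g (insert e F) s t"
  then show "conn g F s t \<or> conn g F s u \<and> conn g F z t \<or> conn g F s z \<and> conn g F u t"
  proof (induction rule: conn_induct)
    case refl
    then show ?case by simp
  next
    case (step x y e')
    show ?case
    proof (cases "e' \<in> F")
      case True
      then have "conn g F x y" using step conn_edge by metis
      then show ?thesis using step.IH conn_trans by metis
    next
      case False
      then have "{x, y} = {u, z}" using step assms by auto
      then have "x = u \<and> y = z \<or> x = z \<and> y = u" by (auto simp: doubleton_eq_iff)
      then show ?thesis using step.IH conn_refl conn_trans conn_sym by metis
    qed
  qed
next
  have uz: "conn g (insert e F) u z" using assms by (auto intro: conn_edge)
  have m: "conn g F x y \<Longrightarrow> conn g (insert e F) x y" for x y
    by (erule conn_mono) auto
  assume "conn g F s t \<or> conn g F s u \<and> conn g F z t \<or> conn g F s z \<and> conn g F u t"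
  then show "conn g (insert e F) s t"
    using m uz conn_trans conn_sym by metis
qed

lemma forest_mono: "forest g F \<Longrightarrow> F' \<subseteq> F \<Longrightarrow> forest g F'"
  unfolding forest_def by (meson conn_mono Diff_mono subset_refl subsetD)

text \<open>For the direction from right to left: a cycle in the enlarged set through an old edge
  \<open>e'\<close> either avoids \<open>e\<close>, contradicting that \<open>F\<close> is a forest,
  or becomes a connection of \<open>u\<close> and \<open>z\<close> inside \<open>F\<close> when
  \<open>e\<close> is taken out.\<close>

lemma forest_insert:
  assumes "g e = {u, z}" "e \<notin> F"
  shows "forest g (insert e F) \<longleftrightarrow> forest g F \<and> \<not> conn g F u z"
proof (intro iffI conjI)
  assume f: "forest g (insert e F)"
  show "forest g F" using f by (rule forest_mono) auto
  show "\<not> conn g F u z" using f assms unfolding forest_def by auto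
next
  assume f: "forest g F \<and> \<not> conn g F u z"
  show "forest g (insert e F)"
    unfolding forest_def
  proof (intro ballI allI impI notI)
    fix e' s t assume e': "e' \<in> insert e F" "g e' = {s, t}"
      and c: "conn g (insert e F - {e'}) s t"
    show False
    proof (cases "e' = e")
      case True
      then have "conn g F s t" "{s, t} = {u, z}" using c assms e' by auto
      then show False using f conn_sym by (metis doubleton_eq_iff)
    next
      case False
      then have e'F: "e' \<in> F" using e' by simp
      have "insert e F - {e'} = insert e (F - {e'})" using False by auto
      then have "conn g (F - {e'}) s t \<or> conn g (F - {e'}) s u \<and> conn g (F - {e'}) z t
          \<or> conn g (F - {e'}) s z \<and> conn g (F - {e'}) u t"
        using c conn_insert[of g e u z "F - {e'}" s t] assms(1) by simp
      moreover have "\<not> conn g (F - {e'}) s t"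
        using f e'F e'(2) unfolding forest_def by blast
      moreover have "conn g F s t" using e'F e'(2) by (rule conn_edge)
      moreover have "conn g (F - {e'}) x y \<Longrightarrow> conn g F x y" for x y
        by (erule conn_mono) auto
      ultimately have "conn g F u z" using conn_trans conn_sym by metis
      then show False using f by simp
    qed
  qed
qed

lemma conn_isolated:
  assumes "\<And>e. e \<in> F \<Longrightarrow> u \<notin> g e"
  shows "conn g F u v \<longleftrightarrow> u = v"
proof
  assume "conn g F u v"
  then show "u = v"
  proof (induction rule: conn_induct)
    case (step x y e)
    then have "u \<in> g e" by blast
    then show ?case using assms step.hyps by blast
  qed (rule refl)
qed auto

lemma conn_isolated':
  assumes "\<And>e. e \<in> F \<Longrightarrow> u \<notin> g e"
  shows "conn g F v u \<longleftrightarrow> u = v"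
  by (subst conn_commute) (rule conn_isolated, rule assms)

lemma rooted_forest_single_cong:
  assumes "r \<in> V" "r' \<in> V"
  shows "rooted_forest g V [r] F \<longleftrightarrow> rooted_forest g V [r'] F"
  using assms unfolding rooted_forest_def by (simp, meson conn_sym conn_trans)

lemma rooted_forest_swap: "rooted_forest g V [r, s] F \<longleftrightarrow> rooted_forest g V [s, r] F"
  unfolding rooted_forest_def using conn_commute[of g F r s] by auto

lemma rooted_forest_loop:
  assumes "g e = {u}"
  shows "\<not> rooted_forest g V rs (insert e F)"
proof -
  have "\<not> forest g (insert e F)"
    using assms unfolding forest_def by (metis conn_refl insertI1 insert_absorb2)
  then show ?thesis by (simp add: rooted_forest_def)
qed

section \<open>Spanning trees as rooted forests\<close>

lemma walk_conn:
  assumes "walk G u s w" "set (map fst s) \<subseteq> F"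
  shows "conn (ends G) F u w"
  using assms
proof (induction G u s w rule: walk.induct)
  case (2 G u e x s w)
  then have "conn (ends G) F u x" by (intro conn_edge[of e]) auto
  moreover have "conn (ends G) F x w" using 2 by auto
  ultimately show ?case by (rule conn_trans)
qed simp

lemma walk_edges: "walk G u s w \<Longrightarrow> set (map fst s) \<subseteq> edges G"
  by (induction G u s w rule: walk.induct) auto

lemma walk_edge_ends:
  "walk G u s w \<Longrightarrow> e \<in> set (map fst s) \<Longrightarrow> ends G e \<subseteq> set (u # map snd s)"
  by (induction G u s w rule: walk.induct) auto

lemma walk_append:
  "walk G u (s @ t) w \<Longrightarrow> (s \<noteq> [] \<Longrightarrow> walk G (snd (last s)) t w)"
  by (induction G u s w rule: walk.induct) (auto split: if_splits)

text \<open>The walk is built backwards from its end \<open>w\<close>. A new first vertex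
  \<open>y\<close> also makes the new edge fresh, since the ends of used edges lie on the walk; a
  vertex met before is handled by keeping only the part of the walk from there on.\<close>

lemma conn_simple_walk:
  assumes "conn (ends G) F u w" "F \<subseteq> edges G" "\<And>e. e \<in> F \<Longrightarrow> ends G e \<subseteq> verts G"
    and "w \<in> verts G"
  shows "\<exists>s. walk G u s w \<and> set (map fst s) \<subseteq> F \<and> distinct (map fst s) \<and> distinct (u # map snd s)"
proof -
  have "conn (ends G) F w u" using assms(1) by (rule conn_sym)
  then show ?thesis
  proof (induction rule: conn_induct)
    case refl
    then show ?case using assms(4) by (intro exI[of _ "[]"]) auto
  next
    case (step x y e)
    then obtain s where s: "walk G x s w" "set (map fst s) \<subseteq> F" "distinct (map fst s)"
      "distinct (x # map snd s)" by blast
    show ?case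
    proof (cases "y \<in> set (x # map snd s)")
      case False
      have "e \<notin> set (map fst s)"
        using walk_edge_ends[OF s(1), of e] step.hyps(3) False by auto
      moreover have "y \<in> verts G" using assms(3)[OF step.hyps(2)] step.hyps(3) by simp
      then have "walk G y ((e, x) # s) w"
        using s(1) step.hyps assms(2) by (auto simp: insert_commute)
      ultimately show ?thesis using s step False by (intro exI[of _ "(e, x) # s"]) auto
    next
      case True
      show ?thesis
      proof (cases "y = x")
        case True then show ?thesis using s by blast
      next
        case False
        then obtain e' where "(e', y) \<in> set s" using True by auto
        then obtain s1 s2 where sp: "s = s1 @ (e', y) # s2" by (meson split_list)
        have "walk G y s2 w" using walk_append[of G x "s1 @ [(e', y)]" s2 w] s(1) sp by simp
        then show ?thesis using s sp by (intro exI[of _ s2]) auto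
      qed
    qed
  qed
qed

text \<open>Cycles correspond to edges that are not bridges: such an edge closes a simple walk
  between its ends, and a cycle opened at its first edge connects the ends of that edge without
  it.\<close>

lemma is_tree_iff:
  assumes "wf_graph G" "r \<in> verts G"
  shows "is_tree G \<longleftrightarrow> rooted_forest (ends G) (verts G) [r] (edges G)"
proof -
  let ?g = "ends G"
  have sub: "ends G e \<subseteq> verts G" if "e \<in> edges G" for e
    using assms(1) that unfolding wf_graph_def by fastforce
  have c: "connected_graph G \<longleftrightarrow> (\<forall>z\<in>verts G. conn ?g (edges G) r z)"
  proof
    assume "connected_graph G"
    then show "\<forall>z\<in>verts G. conn ?g (edges G) r z"
      unfolding connected_graph_def using assms(2) walk_conn walk_edges by metis
  next
    assume a: "\<forall>z\<in>verts G. conn ?g (edges G) r z"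
    have "\<exists>s. walk G u s w" if "u \<in> verts G" "w \<in> verts G" for u w
    proof -
      have "conn ?g (edges G) u w" using a that conn_sym conn_trans by metis
      then show ?thesis using conn_simple_walk[of G "edges G" u w] sub that by blast
    qed
    then show "connected_graph G" unfolding connected_graph_def using assms(2) by blast
  qed
  have f: "(\<nexists>u s. is_cycle G u s) \<longleftrightarrow> forest ?g (edges G)"
  proof
    assume nc: "\<nexists>u s. is_cycle G u s"
    show "forest ?g (edges G)"
      unfolding forest_def
    proof (intro ballI allI impI notI)
      fix e u z assume e: "e \<in> edges G" "?g e = {u, z}" and cn: "conn ?g (edges G - {e}) u z"
      have uz: "u \<in> verts G" "z \<in> verts G" using sub e by auto
      obtain s where s: "walk G u s z" "set (map fst s) \<subseteq> edges G - {e}" "distinct (map fst s)"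
        "distinct (u # map snd s)"
        using conn_simple_walk[OF cn] sub uz by auto
      then have "is_cycle G z ((e, u) # s)"
        using e uz by (auto simp: is_cycle_def insert_commute)
      then show False using nc by blast
    qed
  next
    assume fo: "forest ?g (edges G)"
    show "\<nexists>u s. is_cycle G u s"
    proof (intro notI, elim exE)
      fix u s assume cy: "is_cycle G u s"
      then obtain e x s' where s: "s = (e, x) # s'"
        unfolding is_cycle_def by (cases s) auto
      have w: "e \<in> edges G" "?g e = {u, x}" "walk G x s' u" "e \<notin> set (map fst s')"
        using cy s unfolding is_cycle_def by auto
      have "conn ?g (edges G - {e}) x u"
        using walk_edges[OF w(3)] w(4) by (intro walk_conn[OF w(3)]) auto
      then have "conn ?g (edges G - {e}) u x" by (rule conn_sym)
      then show False using fo w unfolding forest_def by blast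
    qed
  qed
  show ?thesis unfolding is_tree_def rooted_forest_def c f by auto
qed

section \<open>The three-root identity\<close>

text \<open>
  The indicator of the side of \<open>e\<close> on which a vertex lies makes the sum additive along the path
  from \<open>b\<close> to \<open>r\<close>, so that it telescopes.
\<close>

lemma unit_flow:
  assumes "finite H" "forest g H" and g: "\<And>e. e \<in> H \<Longrightarrow> g e = {src e, tgt e}"
    and "conn g H b r"
  shows "(\<Sum>e\<in>H. (of_bool (conn g (H - {e}) b (src e)) - of_bool (conn g (H - {e}) r (src e))) *
      (of_bool (u = src e) - of_bool (u = tgt e))) = (of_bool (u = b) - of_bool (u = r) :: 'a::comm_ring_1)"
  using assms(4)
proof (induction rule: conn_induct)
  case refl
  then show ?case by simp
next
  case (step x y e0)
  let ?c = "\<lambda>e x. of_bool (conn g (H - {e}) x (src e)) :: 'a"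
  let ?d = "\<lambda>e. of_bool (u = src e) - of_bool (u = tgt e) :: 'a"
  \<comment> \<open>Removing an edge of the forest separates the neighbours \<open>x\<close> and
    \<open>y\<close> only if this edge is \<open>e0\<close>.\<close>
  have "(?c e x - ?c e y) * ?d e = (if e = e0 then of_bool (u = x) - of_bool (u = y) else 0)"
    if e: "e \<in> H" for e
  proof (cases "e = e0")
    case True
    have n: "\<not> conn g (H - {e0}) x y"
      using assms(2) step.hyps unfolding forest_def by blast
    have "{x, y} = {src e0, tgt e0}" using g step.hyps by metis
    then consider "src e0 = x" "tgt e0 = y" | "src e0 = y" "tgt e0 = x"
      by (auto simp: doubleton_eq_iff)
    then show ?thesis
    proof cases
      case 1
      then show ?thesis using n True conn_commute[of g "H - {e0}" x y] by simp
    next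
      case 2
      then show ?thesis using n True by simp
    qed
  next
    case False
    then have "conn g (H - {e}) x y" using step.hyps conn_edge[of e0 "H - {e}" g x y] by auto
    then have "conn g (H - {e}) x (src e) \<longleftrightarrow> conn g (H - {e}) y (src e)"
      using conn_trans conn_sym by metis
    then show ?thesis using False by simp
  qed
  then have "(\<Sum>e\<in>H. (?c e x - ?c e y) * ?d e) = of_bool (u = x) - of_bool (u = y)"
    using assms(1) step.hyps(2) by simp
  moreover have "(\<Sum>e\<in>H. (?c e b - ?c e y) * ?d e) =
      (\<Sum>e\<in>H. (?c e b - ?c e x) * ?d e) + (\<Sum>e\<in>H. (?c e x - ?c e y) * ?d e)"
    unfolding sum.distrib[symmetric] by (intro sum.cong refl) (simp add: algebra_simps)
  ultimately show ?case using step.IH by simp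
qed

lemma rooted_forest_cut:
  assumes e: "e \<notin> F" "g e = {s, t}" and V: "b \<in> V" "s \<in> V" "t \<in> V"
    and r: "rooted_forest g V R (insert e F) \<Longrightarrow> r \<in> set R \<and> conn g (insert e F) b r"
  shows "of_bool (rooted_forest g V (b # R) F) * (of_bool (conn g F b s) - of_bool (conn g F b t)) =
    (of_bool (rooted_forest g V R (insert e F)) * (of_bool (conn g F b s) - of_bool (conn g F r s))
      :: 'a::comm_ring_1)"
proof -
  note sym = conn_commute[of g F]
  note ci = conn_insert[of g e s t F, OF e(2)]
  note fi = forest_insert[of g e s t F, OF e(2) e(1)]
  have 1: "rooted_forest g V R (insert e F)"
    if f: "rooted_forest g V (b # R) F" and ne: "conn g F b s \<noteq> conn g F b t"
  proof -
    have nst: "\<not> conn g F s t" using ne conn_trans conn_sym by metis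
    have fo: "forest g F" and so: "sorted_wrt (\<lambda>r s. \<not> conn g F r s) R"
      and bR: "\<And>x. x \<in> set R \<Longrightarrow> \<not> conn g F b x"
      and co: "\<And>z. z \<in> V \<Longrightarrow> conn g F b z \<or> (\<exists>x\<in>set R. conn g F x z)"
      using f by (auto simp: rooted_forest_def)
    have "forest g (insert e F)" using fi fo nst by simp
    moreover have "\<not> conn g (insert e F) x x'"
      if x: "x \<in> set R" "x' \<in> set R" "\<not> conn g F x x'" for x x'
    proof -
      have "\<not> conn g F x b" "\<not> conn g F x' b" using bR x sym by blast+
      then have "\<not> (conn g F x s \<and> conn g F t x')" "\<not> (conn g F x t \<and> conn g F s x')"
        using ne conn_sym conn_trans by metis+
      then show ?thesis using ci x(3) by blast
    qed
    then have "sorted_wrt (\<lambda>r s. \<not> conn g (insert e F) r s) R"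
      using so by (auto intro: sorted_wrt_mono_rel[rotated])
    moreover have "\<exists>x\<in>set R. conn g (insert e F) x z" if z: "z \<in> V" for z
    proof (cases "conn g F b z")
      case True
      obtain q where q: "q \<in> {s, t}" "\<not> conn g F b q" using ne by blast
      then obtain x where x: "x \<in> set R" "conn g F x q" using co V by blast
      have m: "conn g F p p' \<Longrightarrow> conn g (insert e F) p p'" for p p' using ci by blast
      have "conn g (insert e F) s t" using ci by simp
      then have "conn g (insert e F) q b" using q ne m conn_sym conn_trans
        by (metis empty_iff insert_iff)
      then show ?thesis using x m True conn_trans by metis
    next
      case False
      then show ?thesis using co[OF z] ci by blast
    qed
    ultimately show ?thesis by (simp add: rooted_forest_def)
  qed
  show ?thesis
  proof (cases "rooted_forest g V R (insert e F)")
    case False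
    then have "rooted_forest g V (b # R) F \<Longrightarrow> conn g F b s = conn g F b t" using 1 by blast
    then show ?thesis using False by auto
  next
    case True
    note T = True
    have rR: "r \<in> set R" and br: "conn g (insert e F) b r" using r True by auto
    have nst: "\<not> conn g F s t" and fo: "forest g F" using True fi by (auto simp: rooted_forest_def)
    show ?thesis
    proof (cases "conn g F b r")
      case True
      then have "\<not> rooted_forest g V (b # R) F" using rR by (auto simp: rooted_forest_def)
      moreover have "conn g F b s = conn g F r s" using True conn_trans conn_sym by metis
      ultimately show ?thesis by simp
    next
      case nbr: False
      then have d: "conn g F b s \<and> conn g F t r \<or> conn g F b t \<and> conn g F s r"
        using br ci by blast
      have sR: "sorted_wrt (\<lambda>r s. \<not> conn g (insert e F) r s) R"
        and cR: "\<And>z. z \<in> V \<Longrightarrow> \<exists>x\<in>set R. conn g (insert e F) x z"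
        using T by (auto simp: rooted_forest_def)
      \<comment> \<open>Distinct roots are unconnected in \<open>insert e F\<close>, so after the
        cut no root other than \<open>r\<close> could share a component with
        \<open>b\<close>.\<close>
      have uniq: "x = r" if x: "x \<in> set R" "conn g (insert e F) b x" for x
      proof (rule ccontr)
        assume nx: "x \<noteq> r"
        have cs: "conn g (insert e F) x r" "conn g (insert e F) r x"
          using conn_trans[OF conn_sym[OF that(2)] br] conn_trans[OF conn_sym[OF br] that(2)] by blast+
        obtain i where i: "i < length R" "R ! i = x"
          using x(1) unfolding in_set_conv_nth by blast
        obtain j where j: "j < length R" "R ! j = r"
          using rR unfolding in_set_conv_nth by blast
        note ij = i j
        have "i \<noteq> j" using ij nx by auto
        then have "i < j \<or> j < i" by auto
        then show False using sR ij cs unfolding sorted_wrt_iff_nth_less by blast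
      qed
      have "rooted_forest g V (b # R) F"
      proof -
        have "\<not> conn g F b x" if x: "x \<in> set R" for x
        proof
          assume bx: "conn g F b x"
          then have "x = r" using uniq[OF x] ci by blast
          then show False using bx nbr by simp
        qed
        moreover have "sorted_wrt (\<lambda>r s. \<not> conn g F r s) R"
          using sR ci by (auto intro: sorted_wrt_mono_rel[rotated])
        moreover have "conn g F b z \<or> (\<exists>x\<in>set R. conn g F x z)" if z: "z \<in> V" for z
        proof -
          obtain x where x: "x \<in> set R" "conn g (insert e F) x z" using cR[OF z] by blast
          then have "conn g F x z \<or> conn g F s z \<or> conn g F t z" using ci by blast
          then show ?thesis using d x rR conn_trans conn_sym by metis
        qed
        ultimately show ?thesis using fo by (auto simp: rooted_forest_def)
      qed
      moreover have "conn g F b s \<and> \<not> conn g F b t \<and> \<not> conn g F r s \<or>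
          \<not> conn g F b s \<and> conn g F b t \<and> conn g F r s"
        using d nst nbr conn_trans conn_sym by metis
      ultimately show ?thesis using T by auto
    qed
  qed
qed

text \<open>Forests are weighted by their own edges, as in the matrix-tree theorem for a Laplacian
  with conductances \<open>c\<close>. The Kirchhoff polynomial uses the complementary edges;
  \<open>edge_sum_conductance\<close> translates by inverting the variables.\<close>

definition conductance_sum :: "'e set \<Rightarrow> ('e \<Rightarrow> 'a::comm_ring_1) \<Rightarrow> ('e set \<Rightarrow> bool) \<Rightarrow> 'a" where
  "conductance_sum E c P = (\<Sum>F\<in>Pow E. of_bool (P F) * prod c F)"

text \<open>
  Each pair of an edge \<open>e\<close> and a forest rooted at \<open>b # R\<close> which \<open>e\<close> reconnects gives the forest
  \<open>H\<close> rooted at \<open>R\<close> obtained by adding \<open>e\<close>; summed over \<open>e\<close> with \<open>H\<close> fixed, these pairs form the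
  unit flow from \<open>b\<close> to its root in \<open>H\<close>.
\<close>

lemma laplacian_potential:
  fixes c :: "'e \<Rightarrow> 'a::comm_ring_1"
  assumes E: "finite E" "\<And>e. e \<in> E \<Longrightarrow> g e = {src e, tgt e} \<and> src e \<in> V \<and> tgt e \<in> V"
    and "b \<in> V"
    and root: "\<And>H. H \<subseteq> E \<Longrightarrow> rooted_forest g V R H \<Longrightarrow> \<rho> H \<in> set R \<and> conn g H b (\<rho> H)"
    and X: "X = (\<lambda>u. conductance_sum E c (\<lambda>F. rooted_forest g V (b # R) F \<and> conn g F b u))"
  shows "(\<Sum>e\<in>E. c e * (X (src e) - X (tgt e)) * (of_bool (u = src e) - of_bool (u = tgt e))) =
    (\<Sum>H\<in>Pow E. of_bool (rooted_forest g V R H) * (of_bool (u = b) - of_bool (u = \<rho> H)) * prod c H)"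
proof -
  let ?d = "\<lambda>e. of_bool (u = src e) - of_bool (u = tgt e) :: 'a"
  define A where "A = (\<lambda>F e. of_bool (rooted_forest g V (b # R) F) *
      (of_bool (conn g F b (src e)) - of_bool (conn g F b (tgt e))) * ?d e)"
  have "(\<Sum>e\<in>E. c e * (X (src e) - X (tgt e)) * ?d e) =
      (\<Sum>e\<in>E. \<Sum>F\<in>Pow E. A F e * (c e * prod c F))"
    unfolding X conductance_sum_def A_def sum_subtractf[symmetric] sum_distrib_left sum_distrib_right
    by (intro sum.cong refl) (auto simp: algebra_simps)
  \<comment> \<open>An edge of \<open>F\<close> has both ends in one component, so it carries no
    potential difference.\<close>
  also have "\<dots> = (\<Sum>e\<in>E. \<Sum>F\<in>Pow (E - {e}). A F e * (c e * prod c F))"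
  proof (rule sum.cong[OF refl], rule sum.mono_neutral_right)
    fix e assume e: "e \<in> E"
    show "\<forall>F\<in>Pow E - Pow (E - {e}). A F e * (c e * prod c F) = 0"
    proof
      fix F assume F: "F \<in> Pow E - Pow (E - {e})"
      then have "conn g F (src e) (tgt e)" using E(2)[OF e] by (intro conn_edge[of e]) auto
      then have "conn g F b (src e) \<longleftrightarrow> conn g F b (tgt e)" using conn_trans conn_sym by metis
      then show "A F e * (c e * prod c F) = 0" by (simp add: A_def)
    qed
  qed (use E in auto)
  also have "\<dots> = (\<Sum>(e, F)\<in>(SIGMA e:E. Pow (E - {e})). A F e * (c e * prod c F))"
    using E by (intro sum.Sigma) auto
  also have "\<dots> = (\<Sum>(H, e)\<in>(SIGMA H:Pow E. H). A (H - {e}) e * prod c H)"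
  proof (rule sum.reindex_bij_witness[where j = "\<lambda>(e, F). (insert e F, e)" and i = "\<lambda>(H, e). (e, H - {e})"],
      goal_cases)
    case (5 x)
    obtain e F where x: "x = (e, F)" "e \<in> E" "F \<subseteq> E - {e}" using 5 by auto
    have "finite F" "e \<notin> F" using x finite_subset[OF _ E(1), of F] by auto
    then have "prod c (insert e F) = c e * prod c F" "insert e F - {e} = F" by auto
    then show ?case by (simp add: x(1))
  qed auto
  also have "\<dots> = (\<Sum>H\<in>Pow E. \<Sum>e\<in>H. A (H - {e}) e * prod c H)"
    using E by (intro sum.Sigma[symmetric]) (auto intro: finite_subset)
  also have "\<dots> = (\<Sum>H\<in>Pow E. of_bool (rooted_forest g V R H) *
      (of_bool (u = b) - of_bool (u = \<rho> H)) * prod c H)"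
  proof (intro sum.cong refl)
    fix H assume H: "H \<in> Pow E"
    have "A (H - {e}) e = of_bool (rooted_forest g V R H) *
       ((of_bool (conn g (H - {e}) b (src e)) - of_bool (conn g (H - {e}) (\<rho> H) (src e))) * ?d e)"
      if e: "e \<in> H" for e
    proof -
      have i: "insert e (H - {e}) = H" using e by auto
      have "e \<in> E" using e H by auto
      then have "of_bool (rooted_forest g V (b # R) (H - {e})) *
          (of_bool (conn g (H - {e}) b (src e)) - of_bool (conn g (H - {e}) b (tgt e))) =
        (of_bool (rooted_forest g V R (insert e (H - {e}))) *
          (of_bool (conn g (H - {e}) b (src e)) - of_bool (conn g (H - {e}) (\<rho> H) (src e))) :: 'a)"
        using E(2)[of e] root[of H] H
        by (intro rooted_forest_cut[where t = "tgt e"] assms(3)) (auto simp: insert_absorb[OF e])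
      then show ?thesis unfolding A_def i by (simp only: mult.assoc[symmetric])
    qed
    then have "(\<Sum>e\<in>H. A (H - {e}) e * prod c H) = of_bool (rooted_forest g V R H) *
       (\<Sum>e\<in>H. (of_bool (conn g (H - {e}) b (src e)) - of_bool (conn g (H - {e}) (\<rho> H) (src e))) * ?d e)
       * prod c H"
      by (simp add: sum_distrib_left sum_distrib_right)
    also have "\<dots> = of_bool (rooted_forest g V R H) * (of_bool (u = b) - of_bool (u = \<rho> H)) * prod c H"
    proof (cases "rooted_forest g V R H")
      case True
      then have "forest g H" "conn g H b (\<rho> H)" "finite H"
        using root[of H] H E(1) finite_subset by (auto simp: rooted_forest_def)
      then have "(\<Sum>e\<in>H. (of_bool (conn g (H - {e}) b (src e)) -
          of_bool (conn g (H - {e}) (\<rho> H) (src e))) * ?d e) = of_bool (u = b) - of_bool (u = \<rho> H)"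
        using E(2) H by (intro unit_flow) auto
      then show ?thesis by (simp only:)
    qed simp
    finally show "(\<Sum>e\<in>H. A (H - {e}) e * prod c H) = \<dots>" .
  qed
  finally show ?thesis .
qed

text \<open>
  Green's identity, i.e. the symmetry of the Laplacian, for the potentials with source \<open>b\<close> that
  are grounded at \<open>y\<close> and at \<open>a, y\<close>.
\<close>

lemma conductance_sum_identity:
  fixes c :: "'e \<Rightarrow> 'a::comm_ring_1"
  assumes "finite E" "finite V" and E: "\<And>e. e \<in> E \<Longrightarrow> \<exists>x\<in>V. \<exists>y\<in>V. g e = {x, y}"
    and V: "a \<in> V" "b \<in> V" "y \<in> V"
  shows "conductance_sum E c (rooted_forest g V [y]) * conductance_sum E c (rooted_forest g V [b, a, y]) =
    conductance_sum E c (rooted_forest g V [a, y]) * conductance_sum E c (rooted_forest g V [b, y]) -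
    (conductance_sum E c (\<lambda>F. rooted_forest g V [a, y] F \<and> conn g F a b))\<^sup>2"
proof -
  let ?S = "conductance_sum E c"
  define X where "X = (\<lambda>u. ?S (\<lambda>F. rooted_forest g V (b # [y]) F \<and> conn g F b u))"
  define Y where "Y = (\<lambda>u. ?S (\<lambda>F. rooted_forest g V (b # [a, y]) F \<and> conn g F b u))"
  obtain src tgt where st: "\<And>e. e \<in> E \<Longrightarrow> g e = {src e, tgt e} \<and> src e \<in> V \<and> tgt e \<in> V"
    using E by metis
  \<comment> \<open>The root in the component of \<open>b\<close>, for a forest rooted at
    \<open>a\<close> and \<open>y\<close>.\<close>
  define \<rho> where "\<rho> = (\<lambda>H. if conn g H a b then a else y)"
  let ?d = "\<lambda>u e. of_bool (u = src e) - of_bool (u = tgt e) :: 'a"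
  have pair: "(\<Sum>u\<in>V. of_bool (u = s) * W u) = (W s :: 'a)" if "s \<in> V" for s W
  proof -
    have "(\<Sum>u\<in>V. of_bool (u = s) * W u) = (\<Sum>u\<in>V. if u = s then W u else 0)"
      by (intro sum.cong) auto
    then show ?thesis using that assms(2) by simp
  qed
  then have pd: "(\<Sum>u\<in>V. (of_bool (u = s) - of_bool (u = t)) * W u) = (W s - W t :: 'a)"
    if "s \<in> V" "t \<in> V" for s t W
    using that by (simp add: left_diff_distrib sum_subtractf)
  have green: "(\<Sum>u\<in>V. (\<Sum>e\<in>E. c e * (U (src e) - U (tgt e)) * ?d u e) * W u) =
      (\<Sum>e\<in>E. c e * (U (src e) - U (tgt e)) * (W (src e) - W (tgt e)))" for U W
  proof -
    have "(\<Sum>u\<in>V. (\<Sum>e\<in>E. c e * (U (src e) - U (tgt e)) * ?d u e) * W u) =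
      (\<Sum>e\<in>E. c e * (U (src e) - U (tgt e)) * (\<Sum>u\<in>V. ?d u e * W u))"
      unfolding sum_distrib_left sum_distrib_right by (subst sum.swap) (simp add: mult.assoc)
    also have "\<dots> = (\<Sum>e\<in>E. c e * (U (src e) - U (tgt e)) * (W (src e) - W (tgt e)))"
      using st by (intro sum.cong refl) (simp add: pd)
    finally show ?thesis .
  qed
  \<comment> \<open>Up to the factor given by the tree sum, \<open>X\<close> is the potential of a
    unit current from \<open>b\<close> to \<open>y\<close>. The current of \<open>Y\<close> leaves
    at \<open>a\<close> and \<open>y\<close>, in proportions determined by
    \<open>\<rho>\<close>.\<close>
  have LX: "(\<Sum>e\<in>E. c e * (X (src e) - X (tgt e)) * ?d u e) =
      ?S (rooted_forest g V [y]) * (of_bool (u = b) - of_bool (u = y))" for u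
  proof -
    have "(\<Sum>e\<in>E. c e * (X (src e) - X (tgt e)) * ?d u e) =
      (\<Sum>H\<in>Pow E. of_bool (rooted_forest g V [y] H) * (of_bool (u = b) - of_bool (u = y)) * prod c H)"
      by (rule laplacian_potential[OF assms(1) st V(2) _ X_def])
        (use V conn_commute[of g _ b y] in \<open>auto simp: rooted_forest_def\<close>)
    then show ?thesis
      by (simp add: conductance_sum_def sum_distrib_left sum_distrib_right mult_ac)
  qed
  have LY: "(\<Sum>e\<in>E. c e * (Y (src e) - Y (tgt e)) * ?d u e) =
      (\<Sum>H\<in>Pow E. of_bool (rooted_forest g V [a, y] H) * (of_bool (u = b) - of_bool (u = \<rho> H)) * prod c H)" for u
    by (rule laplacian_potential[OF assms(1) st V(2) _ Y_def])
        (use V conn_commute[of g _ b] in \<open>auto simp: rooted_forest_def \<rho>_def\<close>)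
  have Xb: "X b = ?S (rooted_forest g V [b, y])" by (simp add: X_def)
  have Xy: "X y = 0" 
  proof -
    have "\<not> (rooted_forest g V (b # [y]) F \<and> conn g F b y)" for F by (auto simp: rooted_forest_def)
    then have "\<And>F. (rooted_forest g V (b # [y]) F \<and> conn g F b y) = False" by blast
    then show ?thesis unfolding X_def conductance_sum_def
      by (simp only: of_bool_eq mult_zero_left sum.neutral_const)
  qed
  have Yb: "Y b = ?S (rooted_forest g V [b, a, y])" by (simp add: Y_def)
  have Yy: "Y y = 0" 
  proof -
    have "\<not> (rooted_forest g V (b # [a, y]) F \<and> conn g F b y)" for F by (auto simp: rooted_forest_def)
    then have "\<And>F. (rooted_forest g V (b # [a, y]) F \<and> conn g F b y) = False" by blast
    then show ?thesis unfolding Y_def conductance_sum_def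
      by (simp only: of_bool_eq mult_zero_left sum.neutral_const)
  qed
  have "rooted_forest g V [b, y] F \<and> conn g F b a \<longleftrightarrow> rooted_forest g V [a, y] F \<and> conn g F a b" for F
    unfolding rooted_forest_def using conn_commute[of g F a b] conn_trans[of g F]
    by auto
  then have Xa: "X a = ?S (\<lambda>F. rooted_forest g V [a, y] F \<and> conn g F a b)" by (simp add: X_def)
  have "?S (rooted_forest g V [y]) * Y b = (\<Sum>u\<in>V. ?S (rooted_forest g V [y]) *
      ((of_bool (u = b) - of_bool (u = y)) * Y u))"
    unfolding sum_distrib_left[symmetric] using pd[of b y Y] V Yy by simp
  also have "\<dots> = (\<Sum>u\<in>V. (\<Sum>e\<in>E. c e * (X (src e) - X (tgt e)) * ?d u e) * Y u)"
    unfolding LX by (simp add: mult.assoc)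
  also have "\<dots> = (\<Sum>u\<in>V. (\<Sum>e\<in>E. c e * (Y (src e) - Y (tgt e)) * ?d u e) * X u)"
    unfolding green by (intro sum.cong refl) (simp add: mult_ac)
  also have "\<dots> = (\<Sum>H\<in>Pow E. of_bool (rooted_forest g V [a, y] H) * prod c H * (\<Sum>u\<in>V. (of_bool (u = b) - of_bool (u = \<rho> H)) * X u))"
    unfolding LY sum_distrib_left sum_distrib_right by (subst sum.swap) (simp add: mult_ac)
  \<comment> \<open>The potential \<open>X\<close> is grounded at \<open>y\<close>, so a sink
    contributes only if it is \<open>a\<close>.\<close>
  also have "\<dots> = (\<Sum>H\<in>Pow E. of_bool (rooted_forest g V [a, y] H) * prod c H * (X b - of_bool (conn g H a b) * X a))"
    using V Xy by (intro sum.cong refl) (auto simp: pd \<rho>_def)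
  also have "\<dots> = ?S (rooted_forest g V [a, y]) * X b - ?S (\<lambda>F. rooted_forest g V [a, y] F \<and> conn g F a b) * X a"
    unfolding conductance_sum_def right_diff_distrib sum_subtractf sum_distrib_right
    by (simp add: mult_ac of_bool_conj)
  finally show ?thesis using Xa Xb Yb by (simp add: power2_eq_square)
qed

section \<open>Forest sums as polynomials in the edge variables\<close>

definition edge_sum :: "'e set \<Rightarrow> ('e set \<Rightarrow> 'a::comm_ring_1) \<Rightarrow> ('e \<Rightarrow> 'a) \<Rightarrow> 'a" where
  "edge_sum E w \<alpha> = (\<Sum>F\<in>Pow E. w F * prod \<alpha> (E - F))"

lemma edge_sum_cong:
  "(\<And>F. F \<subseteq> E \<Longrightarrow> w F = w' F) \<Longrightarrow> edge_sum E w \<alpha> = edge_sum E w' \<alpha>"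
  by (simp add: edge_sum_def)

lemma edge_sum_zero [simp]: "edge_sum E (\<lambda>F. 0) \<alpha> = 0"
  by (simp add: edge_sum_def)

lemma edge_sum_diff: "edge_sum E (\<lambda>F. w F - w' F) \<alpha> = edge_sum E w \<alpha> - edge_sum E w' \<alpha>"
  by (simp add: edge_sum_def sum_subtractf left_diff_distrib)

lemma edge_sum_add: "edge_sum E (\<lambda>F. w F + w' F) \<alpha> = edge_sum E w \<alpha> + edge_sum E w' \<alpha>"
  by (simp add: edge_sum_def sum.distrib distrib_right)

lemma edge_sum_upd [simp]: "e \<notin> E \<Longrightarrow> edge_sum E w (\<alpha>(e := x)) = edge_sum E w \<alpha>"
  unfolding edge_sum_def by (intro sum.cong refl arg_cong2[of _ _ _ _ "(*)"] prod.cong) auto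

text \<open>Deletion and contraction: sets avoiding \<open>e\<close> keep the factor
  \<open>\<alpha> e\<close>, sets containing it lose this factor. Every forest sum is therefore
  affine in each variable.\<close>

lemma edge_sum_insert:
  assumes "finite E" "e \<notin> E"
  shows "edge_sum (insert e E) w \<alpha> = \<alpha> e * edge_sum E w \<alpha> + edge_sum E (\<lambda>F. w (insert e F)) \<alpha>"
proof -
  have "edge_sum (insert e E) w \<alpha> = (\<Sum>F\<in>Pow E. w F * prod \<alpha> (insert e E - F)) +
      (\<Sum>F\<in>insert e ` Pow E. w F * prod \<alpha> (insert e E - F))"
    unfolding edge_sum_def Pow_insert using assms by (intro sum.union_disjoint) auto
  moreover have "(\<Sum>F\<in>Pow E. w F * prod \<alpha> (insert e E - F)) = \<alpha> e * edge_sum E w \<alpha>"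
    unfolding edge_sum_def sum_distrib_left
  proof (intro sum.cong refl)
    fix F assume "F \<in> Pow E"
    then have "insert e E - F = insert e (E - F)" "e \<notin> E - F" "finite (E - F)" using assms by auto
    then show "w F * prod \<alpha> (insert e E - F) = \<alpha> e * (w F * prod \<alpha> (E - F))"
      by (simp add: mult_ac)
  qed
  moreover have "(\<Sum>F\<in>insert e ` Pow E. w F * prod \<alpha> (insert e E - F)) =
      (\<Sum>F\<in>Pow E. w (insert e F) * prod \<alpha> (insert e E - insert e F))"
    using assms by (subst sum.reindex) (auto simp: inj_on_def)
  moreover have "\<dots> = edge_sum E (\<lambda>F. w (insert e F)) \<alpha>"
    unfolding edge_sum_def using assms
    by (intro sum.cong refl arg_cong2[of _ _ _ _ "(*)"] prod.cong) auto
  ultimately show ?thesis by simp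
qed

lemma edge_sum_conductance:
  fixes \<alpha> :: "'e \<Rightarrow> 'a::field"
  assumes "finite E" "\<And>e. e \<in> E \<Longrightarrow> \<alpha> e \<noteq> 0"
  shows "edge_sum E (\<lambda>F. of_bool (P F)) \<alpha> = prod \<alpha> E * conductance_sum E (\<lambda>e. inverse (\<alpha> e)) P"
  unfolding edge_sum_def conductance_sum_def sum_distrib_left
proof (intro sum.cong refl)
  fix F assume F: "F \<in> Pow E"
  then have "finite F" using assms(1) finite_subset by auto
  have "prod \<alpha> E = prod \<alpha> (E - F) * prod \<alpha> F"
    using F assms(1) prod.subset_diff[of F E \<alpha>] by auto
  moreover have "prod \<alpha> F * (\<Prod>e\<in>F. inverse (\<alpha> e)) = 1"
    unfolding prod.distrib[symmetric] using F assms by (intro prod.neutral) auto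
  ultimately show "of_bool (P F) * prod \<alpha> (E - F) =
      prod \<alpha> E * (of_bool (P F) * (\<Prod>e\<in>F. inverse (\<alpha> e)))"
    by (simp add: mult_ac)
qed

text \<open>The conductance form needs invertible variables, but variables divisible by
  \<open>p\<close> occur. Both sides depend on the residues only, so other representatives may be
  taken; over the reals both sides are then the square of the product of all variables times the two
  sides of \<open>conductance_sum_identity\<close>.\<close>

lemma edge_sum_identity:
  fixes \<alpha> :: "'e \<Rightarrow> int" and p :: nat
  assumes "finite E" "finite V" "\<And>e. e \<in> E \<Longrightarrow> \<exists>x\<in>V. \<exists>y\<in>V. g e = {x, y}"
    and "a \<in> V" "b \<in> V" "y \<in> V" and "p > 0"
  shows "[edge_sum E (\<lambda>F. of_bool (rooted_forest g V [y] F)) \<alpha> *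
      edge_sum E (\<lambda>F. of_bool (rooted_forest g V [b, a, y] F)) \<alpha> =
      edge_sum E (\<lambda>F. of_bool (rooted_forest g V [a, y] F)) \<alpha> *
      edge_sum E (\<lambda>F. of_bool (rooted_forest g V [b, y] F)) \<alpha> -
      (edge_sum E (\<lambda>F. of_bool (rooted_forest g V [a, y] F \<and> conn g F a b)) \<alpha>)\<^sup>2] (mod int p)"
proof -
  \<comment> \<open>Positive representatives, so that the conductances \<open>1 / \<beta> e\<close> exist.\<close>
  define \<beta> where "\<beta> = (\<lambda>e. \<alpha> e mod int p + int p)"
  have pos: "\<beta> e > 0" for e using assms(7) by (simp add: \<beta>_def add_nonneg_pos)
  have cong: "[edge_sum E w \<alpha> = edge_sum E w \<beta>] (mod int p)" for w
    unfolding edge_sum_def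
    by (intro cong_sum cong_mult cong_refl cong_prod) (simp add: \<beta>_def cong_def)
  define S where "S = (\<lambda>P. edge_sum E (\<lambda>F. of_bool (P F)) \<beta>)"
  define C where "C = conductance_sum E (\<lambda>e. inverse (real_of_int (\<beta> e)))"
  define \<pi> where "\<pi> = (\<Prod>e\<in>E. real_of_int (\<beta> e))"
  have S: "real_of_int (S P) = \<pi> * C P" for P
  proof -
    have "real_of_int (S P) = edge_sum E (\<lambda>F. of_bool (P F)) (\<lambda>e. real_of_int (\<beta> e))"
      by (simp add: S_def edge_sum_def)
    also have "\<dots> = \<pi> * C P"
      unfolding \<pi>_def C_def using pos less_imp_neq[of 0]
      by (intro edge_sum_conductance assms(1)) (simp add: less_imp_neq[THEN not_sym])
    finally show ?thesis .
  qed
  have "real_of_int (S (rooted_forest g V [y]) * S (rooted_forest g V [b, a, y])) =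
      real_of_int (S (rooted_forest g V [a, y]) * S (rooted_forest g V [b, y]) -
        (S (\<lambda>F. rooted_forest g V [a, y] F \<and> conn g F a b))\<^sup>2)"
    using conductance_sum_identity[of E V g a b y "\<lambda>e. inverse (real_of_int (\<beta> e))", OF assms(1-6)]
    unfolding of_int_mult of_int_diff of_int_power S C_def[symmetric]
    by (simp add: power_mult_distrib power2_eq_square mult_ac right_diff_distrib'[symmetric])
  then have eq: "S (rooted_forest g V [y]) * S (rooted_forest g V [b, a, y]) =
      S (rooted_forest g V [a, y]) * S (rooted_forest g V [b, y]) -
        (S (\<lambda>F. rooted_forest g V [a, y] F \<and> conn g F a b))\<^sup>2"
    using of_int_eq_iff by blast
  show ?thesis
    by (rule cong_trans[OF cong_mult[OF cong cong] cong_sym],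
        rule cong_trans[OF cong_diff[OF cong_mult[OF cong cong] cong_pow[OF cong]]])
      (simp add: eq[unfolded S_def])
qed

section \<open>Counting zeros modulo a prime\<close>

lemma sum_PiE_insert:
  assumes "e \<notin> E"
  shows "(\<Sum>\<alpha>\<in>insert e E \<rightarrow>\<^sub>E S. \<phi> \<alpha>) = (\<Sum>\<alpha>\<in>E \<rightarrow>\<^sub>E S. \<Sum>x\<in>S. \<phi> (\<alpha>(e := x)))"
proof -
  have "(\<Sum>\<alpha>\<in>insert e E \<rightarrow>\<^sub>E S. \<phi> \<alpha>) = (\<Sum>(x, \<alpha>)\<in>S \<times> (E \<rightarrow>\<^sub>E S). \<phi> (\<alpha>(e := x)))"
    unfolding PiE_insert_eq using inj_combinator[OF assms, of "\<lambda>_. S"]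
    by (subst sum.reindex) (auto simp: case_prod_unfold)
  also have "\<dots> = (\<Sum>x\<in>S. \<Sum>\<alpha>\<in>E \<rightarrow>\<^sub>E S. \<phi> (\<alpha>(e := x)))"
    by (simp add: sum.cartesian_product)
  finally show ?thesis by (simp add: sum.swap[of _ S])
qed

text \<open>An integer-valued indicator, so that common zeros become products, inclusion-exclusion
  becomes algebra, and counts can be reduced modulo \<open>q\<close>.\<close>

definition zero_mod :: "int \<Rightarrow> int \<Rightarrow> int" where
  "zero_mod q n = of_bool (q dvd n)"

definition nonzero_mod :: "int \<Rightarrow> int \<Rightarrow> int" where
  "nonzero_mod q n = of_bool (\<not> q dvd n)"

lemma nonzero_mod_eq: "nonzero_mod q n = 1 - zero_mod q n"
  by (simp add: nonzero_mod_def zero_mod_def)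

lemma zero_mod_cong: "[m = n] (mod q) \<Longrightarrow> zero_mod q m = zero_mod q n"
  by (simp add: zero_mod_def cong_dvd_iff)

lemma nonzero_mod_cong: "[m = n] (mod q) \<Longrightarrow> nonzero_mod q m = nonzero_mod q n"
  by (simp add: nonzero_mod_def cong_dvd_iff)

lemma sum_shift_mod:
  fixes q :: int
  assumes "q > 0" "\<And>A. h (A mod q) = h A"
  shows "(\<Sum>y\<in>{0..<q}. h (c + y)) = (\<Sum>A\<in>{0..<q}. h A)"
proof (rule sum.reindex_bij_witness[where j = "\<lambda>y. (c + y) mod q" and i = "\<lambda>A. (A - c) mod q"])
  fix y assume "y \<in> {0..<q}"
  then show "((c + y) mod q - c) mod q = y" by (simp add: mod_diff_left_eq)
next
  fix A assume "A \<in> {0..<q}"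
  then show "(c + (A - c) mod q) mod q = A" by (simp add: mod_add_right_eq)
qed (use assms in auto)

text \<open>A nonzero slope is invertible and gives one zero. The exact count is kept because
  \<open>sum_cone_zeros\<close> has to exhibit the factor \<open>q^2\<close>; elsewhere its residue
  suffices.\<close>

lemma sum_affine_zeros:
  assumes "prime q"
  shows "(\<Sum>x\<in>{0..<q}. zero_mod q (b * x + a)) = (if q dvd b then q * zero_mod q a else 1)"
proof (cases "q dvd b")
  case True
  then have "zero_mod q (b * x + a) = zero_mod q a" for x
    by (simp add: zero_mod_def dvd_add_right_iff)
  then show ?thesis using True prime_gt_0_int[OF assms] by simp
next
  case False
  have q: "q > 0" using prime_gt_0_int[OF assms] .
  have cop: "coprime b q"
    using prime_imp_coprime[OF assms False] by (simp add: coprime_commute)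
  obtain x0 where x0: "[b * x0 = - a] (mod q)" using cong_solve_coprime_int[OF cop]
    by (metis cong_scalar_right mult.assoc mult.left_neutral)
  have "q dvd b * x + a \<longleftrightarrow> x = x0 mod q" if x: "x \<in> {0..<q}" for x
  proof -
    have "q dvd b * x + a \<longleftrightarrow> [b * x = - a] (mod q)"
      by (simp add: cong_iff_dvd_diff)
    also have "\<dots> \<longleftrightarrow> [b * x = b * x0] (mod q)" using x0 cong_trans cong_sym by metis
    also have "\<dots> \<longleftrightarrow> [x = x0] (mod q)" using cop by (simp add: cong_mult_lcancel)
    also have "\<dots> \<longleftrightarrow> x = x0 mod q" using x by (simp add: cong_def)
    finally show ?thesis .
  qed
  then have "(\<Sum>x\<in>{0..<q}. zero_mod q (b * x + a)) = (\<Sum>x\<in>{0..<q}. if x = x0 mod q then 1 else 0)"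
    by (intro sum.cong) (auto simp: zero_mod_def)
  then show ?thesis using False q by simp
qed

lemma sum_affine_zeros_cong:
  assumes "prime q"
  shows "[(\<Sum>x\<in>{0..<q}. zero_mod q (b * x + a)) = nonzero_mod q b] (mod q)"
  by (simp add: sum_affine_zeros[OF assms] nonzero_mod_def cong_def)

lemma sum_affine_nonzeros_cong:
  assumes "prime q"
  shows "[(\<Sum>x\<in>{0..<q}. nonzero_mod q (b * x + a)) = - nonzero_mod q b] (mod q)"
proof -
  have "(\<Sum>x\<in>{0..<q}. nonzero_mod q (b * x + a)) = q - (\<Sum>x\<in>{0..<q}. zero_mod q (b * x + a))"
    using prime_gt_0_int[OF assms] by (simp add: nonzero_mod_eq sum_subtractf)
  moreover have "[q - (\<Sum>x\<in>{0..<q}. zero_mod q (b * x + a)) = 0 - nonzero_mod q b] (mod q)"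
    by (intro cong_diff sum_affine_zeros_cong assms) (simp add: cong_def)
  ultimately show ?thesis by simp
qed

text \<open>The substitution \<open>A = x + y\<close> for fixed \<open>x\<close> permutes the
  residues.\<close>

lemma sum_pair_shift:
  fixes q :: int
  assumes "q > 0" "\<And>A x. h (A mod q) x = h A x"
  shows "(\<Sum>x\<in>{0..<q}. \<Sum>y\<in>{0..<q}. h (x + y) x) = (\<Sum>A\<in>{0..<q}. \<Sum>x\<in>{0..<q}. h A x)"
proof -
  have "(\<Sum>x\<in>{0..<q}. \<Sum>y\<in>{0..<q}. h (x + y) x) = (\<Sum>x\<in>{0..<q}. \<Sum>A\<in>{0..<q}. h A x)"
    using assms by (intro sum.cong refl sum_shift_mod) auto
  also have "\<dots> = (\<Sum>A\<in>{0..<q}. \<Sum>x\<in>{0..<q}. h A x)" by (rule sum.swap)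
  finally show ?thesis .
qed

text \<open>In the variables \<open>A = x + y\<close> and \<open>x\<close> the first factor depends
  on \<open>A\<close> alone, and the second is affine in \<open>x\<close> with slope
  \<open>d - c\<close>. Summing over \<open>x\<close> and then over \<open>A\<close> leaves, modulo
  \<open>q\<close>, the condition that both slopes are nonzero.\<close>

lemma sum_pair_zeros_cong:
  assumes "prime q"
  shows "[(\<Sum>x\<in>{0..<q}. \<Sum>y\<in>{0..<q}. zero_mod q ((x + y) * t + t0) * zero_mod q (y * c + x * d + e)) =
    nonzero_mod q t * nonzero_mod q (d - c)] (mod q)"
proof -
  let ?S = "{0..<q}"
  define h where "h = (\<lambda>A x. zero_mod q (A * t + t0) * zero_mod q ((A - x) * c + x * d + e))"
  have h: "h (A mod q) x = h A x" for A x
    unfolding h_def by (intro arg_cong2[of _ _ _ _ "(*)"] zero_mod_cong cong_add cong_mult cong_diff cong_refl)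
      (simp_all add: cong_def)
  have "(\<Sum>x\<in>?S. \<Sum>y\<in>?S. zero_mod q ((x + y) * t + t0) * zero_mod q (y * c + x * d + e)) =
      (\<Sum>x\<in>?S. \<Sum>y\<in>?S. h (x + y) x)" by (simp add: h_def)
  also have "\<dots> = (\<Sum>A\<in>?S. \<Sum>x\<in>?S. h A x)"
    using sum_pair_shift[of q h] h prime_gt_0_int[OF assms] by simp
  also have "\<dots> = (\<Sum>A\<in>?S. zero_mod q (t * A + t0) * (\<Sum>x\<in>?S. zero_mod q ((d - c) * x + (A * c + e))))"
    unfolding h_def sum_distrib_left by (intro sum.cong refl) (simp add: algebra_simps)
  finally have eq: "(\<Sum>x\<in>?S. \<Sum>y\<in>?S. zero_mod q ((x + y) * t + t0) * zero_mod q (y * c + x * d + e)) = (\<Sum>A\<in>?S. zero_mod q (t * A + t0) * (\<Sum>x\<in>?S. zero_mod q ((d - c) * x + (A * c + e))))" .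
  have "[(\<Sum>A\<in>?S. zero_mod q (t * A + t0) * (\<Sum>x\<in>?S. zero_mod q ((d - c) * x + (A * c + e)))) = (\<Sum>A\<in>?S. zero_mod q (t * A + t0) * nonzero_mod q (d - c))] (mod q)"
    by (intro cong_sum cong_mult cong_refl sum_affine_zeros_cong assms)
  moreover have "[(\<Sum>A\<in>?S. zero_mod q (t * A + t0) * nonzero_mod q (d - c)) =
      nonzero_mod q t * nonzero_mod q (d - c)] (mod q)"
    unfolding sum_distrib_right[symmetric]
    by (intro cong_mult cong_refl sum_affine_zeros_cong assms)
  ultimately show ?thesis unfolding eq by (rule cong_trans)
qed

text \<open>The substitution is the same as for zeros. Each of the two summations now contributes a
  factor -1, and the signs cancel.\<close>

lemma sum_pair_nonzeros_cong:
  assumes "prime q"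
  shows "[(\<Sum>x\<in>{0..<q}. \<Sum>y\<in>{0..<q}. nonzero_mod q ((x + y) * t + t0) * nonzero_mod q (y * c + x * d + e)) =
    nonzero_mod q t * nonzero_mod q (d - c)] (mod q)"
proof -
  let ?S = "{0..<q}"
  define h where "h = (\<lambda>A x. nonzero_mod q (A * t + t0) * nonzero_mod q ((A - x) * c + x * d + e))"
  have h: "h (A mod q) x = h A x" for A x
    unfolding h_def by (intro arg_cong2[of _ _ _ _ "(*)"] nonzero_mod_cong cong_add cong_mult cong_diff cong_refl)
      (simp_all add: cong_def)
  have "(\<Sum>x\<in>?S. \<Sum>y\<in>?S. nonzero_mod q ((x + y) * t + t0) * nonzero_mod q (y * c + x * d + e)) =
      (\<Sum>x\<in>?S. \<Sum>y\<in>?S. h (x + y) x)" by (simp add: h_def)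
  also have "\<dots> = (\<Sum>A\<in>?S. \<Sum>x\<in>?S. h A x)"
    using sum_pair_shift[of q h] h prime_gt_0_int[OF assms] by simp
  also have "\<dots> = (\<Sum>A\<in>?S. nonzero_mod q (t * A + t0) * (\<Sum>x\<in>?S. nonzero_mod q ((d - c) * x + (A * c + e))))"
    unfolding h_def sum_distrib_left by (intro sum.cong refl) (simp add: algebra_simps)
  finally have eq: "(\<Sum>x\<in>?S. \<Sum>y\<in>?S. nonzero_mod q ((x + y) * t + t0) * nonzero_mod q (y * c + x * d + e)) = (\<Sum>A\<in>?S. nonzero_mod q (t * A + t0) * (\<Sum>x\<in>?S. nonzero_mod q ((d - c) * x + (A * c + e))))" .
  have "[(\<Sum>A\<in>?S. nonzero_mod q (t * A + t0) * (\<Sum>x\<in>?S. nonzero_mod q ((d - c) * x + (A * c + e)))) = (\<Sum>A\<in>?S. nonzero_mod q (t * A + t0) * - nonzero_mod q (d - c))] (mod q)"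
    by (intro cong_sum cong_mult cong_refl sum_affine_nonzeros_cong assms)
  moreover have "[(\<Sum>A\<in>?S. nonzero_mod q (t * A + t0) * - nonzero_mod q (d - c)) =
      - nonzero_mod q t * - nonzero_mod q (d - c)] (mod q)"
    unfolding sum_distrib_right[symmetric]
    by (intro cong_mult cong_refl sum_affine_nonzeros_cong assms)
  ultimately have "[(\<Sum>x\<in>?S. \<Sum>y\<in>?S. nonzero_mod q ((x + y) * t + t0) * nonzero_mod q (y * c + x * d + e)) =
      - nonzero_mod q t * - nonzero_mod q (d - c)] (mod q)"
    unfolding eq by (rule cong_trans)
  then show ?thesis by simp
qed

text \<open>Only \<open>x + y\<close> matters, and each residue of it arises from \<open>q\<close>
  pairs.\<close>

lemma sum_pair_zeros_dvd:
  assumes "prime q"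
  shows "q dvd (\<Sum>x\<in>{0..<q}. \<Sum>y\<in>{0..<q}. zero_mod q ((x + y) * t + t0) * zero_mod q ((x + y) * u + u0))"
proof -
  let ?S = "{0..<q}"
  define h where "h = (\<lambda>A (x::int). zero_mod q (A * t + t0) * zero_mod q (A * u + u0))"
  have h: "h (A mod q) x = h A x" for A x
    unfolding h_def by (intro arg_cong2[of _ _ _ _ "(*)"] zero_mod_cong cong_add cong_mult cong_refl)
      (simp_all add: cong_def)
  have "(\<Sum>x\<in>?S. \<Sum>y\<in>?S. zero_mod q ((x + y) * t + t0) * zero_mod q ((x + y) * u + u0)) =
      (\<Sum>x\<in>?S. \<Sum>y\<in>?S. h (x + y) x)" by (simp add: h_def)
  also have "\<dots> = (\<Sum>A\<in>?S. \<Sum>x\<in>?S. h A x)"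
    using sum_pair_shift[of q h] h prime_gt_0_int[OF assms] by simp
  also have "\<dots> = q * (\<Sum>A\<in>?S. h A 0)"
    using prime_gt_0_int[OF assms] by (simp add: h_def sum_distrib_left)
  finally show ?thesis by simp
qed

text \<open>The form is affine in \<open>z\<close> with coefficient \<open>c x y\<close>, so summing
  over \<open>z\<close> leaves the zeros of \<open>c\<close> and the common zeros of
  \<open>c\<close> and \<open>d\<close> to be counted. If \<open>t\<close> is nonzero,
  \<open>c = 0\<close> is a line of \<open>q\<close> points on which \<open>d\<close> has exactly
  one zero, and the total is \<open>q^2 - q + q\<close>.\<close>

lemma sum_cone_zeros:
  assumes q: "prime q" and id: "[t * f = f13 * f23 - f3\<^sup>2] (mod q)"
  shows "(\<Sum>x\<in>{0..<q}. \<Sum>y\<in>{0..<q}. \<Sum>z\<in>{0..<q}.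
      zero_mod q (t * (y * z + x * z + x * y) + f23 * x + f13 * y + (f13 + f23 - 2 * f3) * z + f)) =
    q\<^sup>2 * (1 - zero_mod q t * zero_mod q f13 * zero_mod q f23 * (1 - q * zero_mod q f))"
proof -
  let ?S = "{0..<q}"
  define c where "c = (\<lambda>x y. t * (x + y) + (f13 + f23 - 2 * f3))"
  define d where "d = (\<lambda>x y. t * x * y + f23 * x + f13 * y + f)"
  have q0: "q > 0" using prime_gt_0_int[OF q] .
  have "(\<Sum>z\<in>?S. zero_mod q (t * (y * z + x * z + x * y) + f23 * x + f13 * y + (f13 + f23 - 2 * f3) * z + f))
     = 1 - zero_mod q (c x y) + q * (zero_mod q (c x y) * zero_mod q (d x y))" for x y
  proof -
    have "(\<Sum>z\<in>?S. zero_mod q (t * (y * z + x * z + x * y) + f23 * x + f13 * y + (f13 + f23 - 2 * f3) * z + f))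
      = (\<Sum>z\<in>?S. zero_mod q (c x y * z + d x y))"
      by (intro sum.cong refl arg_cong[of _ _ "zero_mod q"]) (simp add: c_def d_def algebra_simps)
    also have "\<dots> = 1 - zero_mod q (c x y) + q * (zero_mod q (c x y) * zero_mod q (d x y))"
      unfolding sum_affine_zeros[OF q] by (simp add: zero_mod_def)
    finally show ?thesis .
  qed
  then have total: "(\<Sum>x\<in>?S. \<Sum>y\<in>?S. \<Sum>z\<in>?S.
      zero_mod q (t * (y * z + x * z + x * y) + f23 * x + f13 * y + (f13 + f23 - 2 * f3) * z + f)) =
      q\<^sup>2 - (\<Sum>x\<in>?S. \<Sum>y\<in>?S. zero_mod q (c x y)) + q * (\<Sum>x\<in>?S. \<Sum>y\<in>?S. zero_mod q (c x y) * zero_mod q (d x y))"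
    using q0 by (simp add: sum.distrib sum_subtractf sum_distrib_left power2_eq_square)
  show ?thesis
  proof (cases "q dvd t")
    case False
    have c1: "(\<Sum>y\<in>?S. zero_mod q (c x y)) = 1" for x
    proof -
      have "(\<Sum>y\<in>?S. zero_mod q (c x y)) = (\<Sum>y\<in>?S. zero_mod q (t * y + (t * x + (f13 + f23 - 2 * f3))))"
        by (simp add: c_def algebra_simps)
      then show ?thesis using False by (simp add: sum_affine_zeros[OF q])
    qed
    \<comment> \<open>On the line where the coefficient \<open>c\<close> of \<open>z\<close> vanishes, completing the square
      turns \<open>t * d\<close> into minus the square of \<open>t * x + f13 - f3\<close>.\<close>
    have "zero_mod q (c x y) * zero_mod q (d x y) =
        zero_mod q (c x y) * zero_mod q (t * x + (f13 - f3))" for x y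
    proof (cases "q dvd c x y")
      case True
      let ?l = "t * x + (f13 - f3)"
      have "t * d x y = c x y * (?l + f3) - ?l\<^sup>2 + (t * f - (f13 * f23 - f3\<^sup>2))"
        by (simp add: c_def d_def algebra_simps power2_eq_square)
      moreover have "q dvd c x y * (?l + f3)" using True by simp
      moreover have "q dvd t * f - (f13 * f23 - f3\<^sup>2)" using id by (simp add: cong_iff_dvd_diff)
      ultimately have "q dvd t * d x y \<longleftrightarrow> q dvd ?l\<^sup>2"
        by (metis dvd_add_left_iff dvd_diff_commute dvd_diff_right_iff diff_0_right dvd_minus_iff uminus_add_conv_diff dvd_add_right_iff)
      then have "q dvd d x y \<longleftrightarrow> q dvd ?l"
        using False q by (metis prime_dvd_mult_iff prime_dvd_power_iff zero_less_numeral)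
      then show ?thesis by (simp add: zero_mod_def)
    qed (simp add: zero_mod_def)
    then have "(\<Sum>x\<in>?S. \<Sum>y\<in>?S. zero_mod q (c x y) * zero_mod q (d x y)) =
        (\<Sum>x\<in>?S. \<Sum>y\<in>?S. zero_mod q (c x y) * zero_mod q (t * x + (f13 - f3)))" by (simp only:)
    also have "\<dots> = (\<Sum>x\<in>?S. zero_mod q (t * x + (f13 - f3)))"
      by (simp add: sum_distrib_right[symmetric] c1)
    also have "\<dots> = 1" using False by (simp add: sum_affine_zeros[OF q])
    finally have d1: "(\<Sum>x\<in>?S. \<Sum>y\<in>?S. zero_mod q (c x y) * zero_mod q (d x y)) = 1" .
    have "zero_mod q t = 0" using False by (simp add: zero_mod_def)
    then show ?thesis unfolding total d1 using q0 by (simp add: c1)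
  next
    \<comment> \<open>The form is now linear. The identity makes \<open>f3^2\<close> congruent to
      \<open>f13 * f23\<close>, so if the coefficients of \<open>x\<close> and \<open>y\<close>
      vanish, then so does that of \<open>z\<close>, and only the constant \<open>f\<close>
      decides.\<close>
    case True
    have f3: "q dvd f13 * f23 - f3\<^sup>2"
      using id True by (metis cong_dvd_iff dvd_mult2)
    have c: "zero_mod q (c x y) = zero_mod q (f13 + f23 - 2 * f3)" for x y
      using True by (simp add: c_def zero_mod_def dvd_add_right_iff)
    have d: "zero_mod q (d x y) = zero_mod q (f13 * y + (f23 * x + f))" for x y
    proof -
      have "d x y = t * x * y + (f13 * y + (f23 * x + f))" by (simp add: d_def)
      then show ?thesis using True by (simp add: zero_mod_def dvd_add_right_iff)
    qed
    have dd: "(\<Sum>x\<in>?S. \<Sum>y\<in>?S. zero_mod q (d x y)) =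
        (if q dvd f13 then if q dvd f23 then q\<^sup>2 * zero_mod q f else q else q)"
      unfolding d sum_affine_zeros[OF q]
      using q0 by (simp add: sum_distrib_left[symmetric] sum_affine_zeros[OF q] power2_eq_square)
    have f12: "q dvd f13 + f23 - 2 * f3" if "q dvd f13" "q dvd f23"
    proof -
      have "q dvd f3\<^sup>2" using f3 that by (metis dvd_diff_right_iff dvd_mult2)
      then have "q dvd f3" using q prime_dvd_power by blast
      then show ?thesis using that by simp
    qed
    show ?thesis
      unfolding total c sum_distrib_left[symmetric] dd
      using True f12 q0 by (auto simp: zero_mod_def power2_eq_square algebra_simps)
  qed
qed

section \<open>Removing a vertex of small degree\<close>

lemma sorted_wrt_cong:
  assumes "\<And>x y. x \<in> set R \<Longrightarrow> y \<in> set R \<Longrightarrow> P x y \<longleftrightarrow> Q x y"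
  shows "sorted_wrt P R \<longleftrightarrow> sorted_wrt Q R"
  using assms by (auto intro: sorted_wrt_mono_rel[rotated])

lemma conn_pendant:
  assumes "\<And>e. e \<in> F \<Longrightarrow> a \<notin> g e" "g e = {a, a'}"
  shows "conn g (insert e F) a z \<longleftrightarrow> z = a \<or> conn g F a' z"
    and "x \<noteq> a \<Longrightarrow> z \<noteq> a \<Longrightarrow> conn g (insert e F) x z \<longleftrightarrow> conn g F x z"
  using conn_insert[of g e a a' F, OF assms(2)] conn_isolated[of F a g] conn_isolated'[of F a g] assms(1)
  by auto

lemma forest_pendant:
  assumes "\<And>e. e \<in> F \<Longrightarrow> a \<notin> g e" "g e = {a, a'}" "a' \<noteq> a"
  shows "forest g (insert e F) \<longleftrightarrow> forest g F"
proof -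
  have "e \<notin> F" using assms(1)[of e] assms(2) by auto
  then show ?thesis
    using forest_insert[of g e a a' F, OF assms(2)] conn_isolated[of F a g a'] assms by auto
qed

text \<open>An isolated vertex is a component of its own and hence has to be a root.\<close>

lemma rooted_forest_isolated:
  assumes "\<And>e. e \<in> F \<Longrightarrow> a \<notin> g e" "a \<notin> set R"
  shows "\<not> rooted_forest g (insert a V) R F"
    and "a \<notin> V \<Longrightarrow> rooted_forest g (insert a V) (a # R) F \<longleftrightarrow> rooted_forest g V R F"
  using assms conn_isolated[of F a g] conn_isolated'[of F a g]
  unfolding rooted_forest_def by auto

text \<open>The pendant edge can be contracted: the leaf \<open>a\<close> lies in the component of
  \<open>a'\<close>, and if it is a root, it hands this role over to \<open>a'\<close>.\<close>

lemma rooted_forest_pendant: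
  assumes F: "\<And>e. e \<in> F \<Longrightarrow> a \<notin> g e" "g e = {a, a'}" and a: "a' \<in> V" "a \<notin> V" "a \<notin> set R"
  shows "rooted_forest g (insert a V) R (insert e F) \<longleftrightarrow> rooted_forest g V R F"
    and "rooted_forest g (insert a V) (a # R) (insert e F) \<longleftrightarrow> rooted_forest g V (a' # R) F"
proof -
  have n: "a' \<noteq> a" using a by auto
  note c = conn_pendant[of F a g e a', OF F]
  have ca: "conn g (insert e F) x a \<longleftrightarrow> conn g F x a'" if "x \<noteq> a" for x
    using c(1)[of x] that conn_commute by metis
  have s: "sorted_wrt (\<lambda>r s. \<not> conn g (insert e F) r s) R \<longleftrightarrow> sorted_wrt (\<lambda>r s. \<not> conn g F r s) R"
    using a(3) by (intro sorted_wrt_cong) (metis c(2))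
  have f: "forest g (insert e F) \<longleftrightarrow> forest g F" using forest_pendant[of F a g e a', OF F n] .
  have cR: "(\<exists>r\<in>set R. conn g (insert e F) r z) \<longleftrightarrow> (\<exists>r\<in>set R. conn g F r z)" if "z \<noteq> a" for z
    using a(3) c(2) that by metis
  have cRa: "(\<exists>r\<in>set R. conn g (insert e F) r a) \<longleftrightarrow> (\<exists>r\<in>set R. conn g F r a')"
    using a(3) ca by metis
  have V: "z \<in> V \<Longrightarrow> z \<noteq> a" for z using a by auto
  show "rooted_forest g (insert a V) R (insert e F) \<longleftrightarrow> rooted_forest g V R F"
    unfolding rooted_forest_def f s using cR cRa a V by auto
  have "(\<forall>x\<in>set R. \<not> conn g (insert e F) a x) \<longleftrightarrow> (\<forall>x\<in>set R. \<not> conn g F a' x)"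
    using c(1) a(3) by metis
  moreover have "(\<exists>r\<in>set (a # R). conn g (insert e F) r z) \<longleftrightarrow> (\<exists>r\<in>set (a' # R). conn g F r z)"
    if "z \<in> V" for z
    using cR[OF V[OF that]] c(1) V[OF that] by auto
  ultimately show "rooted_forest g (insert a V) (a # R) (insert e F) \<longleftrightarrow> rooted_forest g V (a' # R) F"
    unfolding rooted_forest_def sorted_wrt.simps f s by auto
qed

text \<open>Deleting \<open>w\<close> from a tree leaves one component for each neighbour, and these
  neighbours become the roots.\<close>

lemma rooted_forest_star2:
  assumes F: "\<And>e. e \<in> F \<Longrightarrow> w \<notin> g e" and e: "g e1 = {w, a}" "g e2 = {w, b}" "e1 \<noteq> e2"
    and V: "a \<in> V" "b \<in> V" "w \<notin> V"
  shows "rooted_forest g (insert w V) [w] (insert e1 (insert e2 F)) \<longleftrightarrow> rooted_forest g V [b, a] F"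
proof -
  have nF: "e1 \<notin> insert e2 F" using F[of e1] e by auto
  have n: "w \<noteq> a" "w \<noteq> b" using V by auto
  have c2: "conn g (insert e2 F) w z \<longleftrightarrow> z = w \<or> conn g F b z" for z
    using conn_pendant(1)[of F w g e2 b, OF F e(2)] .
  have "conn g (insert e1 (insert e2 F)) w z \<longleftrightarrow> z = w \<or> conn g F a z \<or> conn g F b z" if "z \<noteq> w" for z
    unfolding conn_insert[of g e1 w a, OF e(1)] using c2 conn_pendant(2)[of F w g e2 b, OF F e(2), of a z] that n
    by (metis conn_refl conn_trans)
  then have "(\<forall>z\<in>insert w V. conn g (insert e1 (insert e2 F)) w z) \<longleftrightarrow>
      (\<forall>z\<in>V. conn g F b z \<or> conn g F a z)" using V by (metis conn_refl insert_iff)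
  moreover have "forest g (insert e1 (insert e2 F)) \<longleftrightarrow> forest g F \<and> \<not> conn g F b a"
    unfolding forest_insert[of g e1 w a, OF e(1) nF] c2 using n forest_pendant[of F w g e2 b, OF F e(2)] by auto
  ultimately show ?thesis unfolding rooted_forest_def by auto
qed

lemma rooted_forest_star3:
  assumes F: "\<And>e. e \<in> F \<Longrightarrow> w \<notin> g e" and e: "g e1 = {w, a}" "g e2 = {w, b}" "g e3 = {w, y}"
      "e1 \<noteq> e2" "e1 \<noteq> e3" "e2 \<noteq> e3"
    and V: "a \<in> V" "b \<in> V" "y \<in> V" "w \<notin> V"
  shows "rooted_forest g (insert w V) [w] (insert e1 (insert e2 (insert e3 F))) \<longleftrightarrow>
    rooted_forest g V [b, a, y] F"
proof -
  have nF: "e1 \<notin> insert e2 (insert e3 F)" "e2 \<notin> insert e3 F" using F[of e1] F[of e2] e by auto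
  have n: "w \<noteq> a" "w \<noteq> b" "w \<noteq> y" using V by auto
  have c3: "conn g (insert e3 F) w z \<longleftrightarrow> z = w \<or> conn g F y z" for z
    using conn_pendant(1)[of F w g e3 y, OF F e(3)] .
  have c2: "conn g (insert e2 (insert e3 F)) w z \<longleftrightarrow> conn g F b z \<or> conn g F y z" if "z \<noteq> w" for z
    unfolding conn_insert[of g e2 w b, OF e(2)] using c3 conn_pendant(2)[of F w g e3 y, OF F e(3), of b z] that n
    by (metis conn_refl conn_trans)
  have m: "conn g F x z \<Longrightarrow> conn g (insert e2 (insert e3 F)) x z" for x z
    by (erule conn_mono) auto
  have c2': "conn g (insert e2 (insert e3 F)) a z \<Longrightarrow> conn g F a z \<or> conn g F b z \<or> conn g F y z"
    if "z \<noteq> w" for z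
    unfolding conn_insert[of g e2 w b, OF e(2)] using c3 conn_pendant(2)[of F w g e3 y, OF F e(3), of a z]
      conn_pendant(2)[of F w g e3 y, OF F e(3), of b z] that n by metis
  have c1: "conn g (insert e1 (insert e2 (insert e3 F))) w z \<longleftrightarrow>
      conn g F a z \<or> conn g F b z \<or> conn g F y z" if z: "z \<noteq> w" for z
  proof -
    have "conn g (insert e1 (insert e2 (insert e3 F))) w z \<longleftrightarrow>
      conn g (insert e2 (insert e3 F)) w z \<or> conn g (insert e2 (insert e3 F)) a z"
      unfolding conn_insert[of g e1 w a, OF e(1)] using conn_refl conn_trans by metis
    then show ?thesis using c2[OF z] c2'[OF z] m by blast
  qed
  then have "(\<forall>z\<in>insert w V. conn g (insert e1 (insert e2 (insert e3 F))) w z) \<longleftrightarrow>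
      (\<forall>z\<in>V. conn g F a z \<or> conn g F b z \<or> conn g F y z)" using V(4) by (metis conn_refl insert_iff)
  moreover have "forest g (insert e1 (insert e2 (insert e3 F))) \<longleftrightarrow>
      forest g F \<and> \<not> conn g F y b \<and> \<not> conn g F b a \<and> \<not> conn g F y a"
    unfolding forest_insert[of g e1 w a, OF e(1) nF(1)] forest_insert[of g e2 w b, OF e(2) nF(2)]
    using c3[of b] c2[of a] n forest_pendant[of F w g e3 y, OF F e(3)] by auto
  ultimately show ?thesis unfolding rooted_forest_def
    using conn_commute[of g F y] by auto
qed

section \<open>Spanning forest polynomials and their dependence on the variables at a vertex of
  degree 2\<close>

definition root_sum :: "('e \<Rightarrow> 'v set) \<Rightarrow> 'v set \<Rightarrow> 'v list \<Rightarrow> 'e set \<Rightarrow> ('e \<Rightarrow> int) \<Rightarrow> int" where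
  "root_sum g V R E \<alpha> = edge_sum E (\<lambda>F. of_bool (rooted_forest g V R F)) \<alpha>"

text \<open>The spanning forest polynomial of the partition with \<open>r\<close> and
  \<open>u\<close> in one part and \<open>y\<close> in the other.\<close>

definition split_sum :: "('e \<Rightarrow> 'v set) \<Rightarrow> 'v set \<Rightarrow> 'v \<Rightarrow> 'v \<Rightarrow> 'v \<Rightarrow> 'e set \<Rightarrow> ('e \<Rightarrow> int) \<Rightarrow> int" where
  "split_sum g V r y u E \<alpha> = edge_sum E (\<lambda>F. of_bool (rooted_forest g V [r, y] F \<and> conn g F r u)) \<alpha>"

lemma root_sum_upd [simp]: "e \<notin> E \<Longrightarrow> root_sum g V R E (\<alpha>(e := x)) = root_sum g V R E \<alpha>"
  by (simp add: root_sum_def)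

lemma split_sum_upd [simp]: "e \<notin> E \<Longrightarrow> split_sum g V r y u E (\<alpha>(e := x)) = split_sum g V r y u E \<alpha>"
  by (simp add: split_sum_def)

lemma root_sum_single_cong:
  assumes "r \<in> V" "r' \<in> V"
  shows "root_sum g V [r] E \<alpha> = root_sum g V [r'] E \<alpha>"
  unfolding root_sum_def using rooted_forest_single_cong[OF assms, of g] by simp

lemma root_sum_swap: "root_sum g V [r, s] E \<alpha> = root_sum g V [s, r] E \<alpha>"
  unfolding root_sum_def using rooted_forest_swap[of g V r s] by simp

lemma split_forest_swap:
  "rooted_forest g V [r, y] F \<and> conn g F r u \<longleftrightarrow> rooted_forest g V [u, y] F \<and> conn g F u r"
  unfolding rooted_forest_def using conn_commute[of g F r u] conn_trans[of g F] by auto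

lemma split_sum_swap: "split_sum g V r y u E \<alpha> = split_sum g V u y r E \<alpha>"
  unfolding split_sum_def using split_forest_swap[of g V r y] by simp

lemma edge_sum_insert2:
  assumes "finite E" "e \<notin> E" "e' \<notin> E" "e \<noteq> e'"
  shows "edge_sum (insert e (insert e' E)) w \<alpha> = \<alpha> e * \<alpha> e' * edge_sum E w \<alpha> +
    \<alpha> e' * edge_sum E (\<lambda>F. w (insert e F)) \<alpha> + \<alpha> e * edge_sum E (\<lambda>F. w (insert e' F)) \<alpha> +
    edge_sum E (\<lambda>F. w (insert e (insert e' F))) \<alpha>"
  using assms by (simp add: edge_sum_insert algebra_simps)

text \<open>In a 2-forest separating \<open>a\<close> from \<open>b\<close>, the vertex
  \<open>y\<close> lies with one of them. The other two root sums count these two kinds of forests,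
  and each counts in addition the forests with \<open>a\<close> and \<open>b\<close> on one side.
  This gives the coefficient of the third variable in the shape needed by
  \<open>sum_cone_zeros\<close>.\<close>

lemma root_sum_two_roots:
  assumes "a \<in> V" "b \<in> V" "y \<in> V"
  shows "root_sum g V [a, b] E \<alpha> =
    root_sum g V [a, y] E \<alpha> + root_sum g V [b, y] E \<alpha> - 2 * split_sum g V a y b E \<alpha>"
proof -
  have "of_bool (rooted_forest g V [a, b] F) + (of_bool (rooted_forest g V [a, y] F \<and> conn g F a b) +
      of_bool (rooted_forest g V [a, y] F \<and> conn g F a b)) =
      (of_bool (rooted_forest g V [a, y] F) + of_bool (rooted_forest g V [b, y] F) :: int)"
    for F
  proof (cases "forest g F")
    case True
    note t = conn_trans[of g F] and s = conn_commute[of g F]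
    show ?thesis
    proof (cases "conn g F a b")
      case True
      then have "rooted_forest g V [a, y] F \<longleftrightarrow> rooted_forest g V [b, y] F"
        using split_forest_swap[of g V a y F b] s[of a b] by blast
      moreover have "\<not> rooted_forest g V [a, b] F" using True by (simp add: rooted_forest_def)
      ultimately show ?thesis using True by simp
    next
      case False
      show ?thesis
      proof (cases "conn g F a y \<or> conn g F b y")
        case True
        then show ?thesis
        proof
          assume c: "conn g F a y"
          then have "rooted_forest g V [a, b] F \<longleftrightarrow> rooted_forest g V [b, y] F"
            using split_forest_swap[of g V a b F y] s[of a y] rooted_forest_swap[of g V y b F] by blast
          then show ?thesis using c False by (auto simp: rooted_forest_def)
        next
          assume c: "conn g F b y"
          then have "rooted_forest g V [a, b] F \<longleftrightarrow> rooted_forest g V [a, y] F"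
            using split_forest_swap[of g V b a F y] s[of b y] rooted_forest_swap[of g V b a F]
              rooted_forest_swap[of g V y a F] by blast
          then show ?thesis using c False by (auto simp: rooted_forest_def)
        qed
      next
        case nc: False
        then have "\<not> rooted_forest g V [a, b] F" using assms by (auto simp: rooted_forest_def)
        moreover have "\<not> conn g F y b" "\<not> conn g F y a" "\<not> conn g F b a"
          using nc False s by blast+
        then have "\<not> rooted_forest g V [a, y] F" "\<not> rooted_forest g V [b, y] F"
          using assms False by (auto simp: rooted_forest_def)
        ultimately show ?thesis by simp
      qed
    qed
  qed (simp add: rooted_forest_def)
  then have "root_sum g V [a, b] E \<alpha> + (split_sum g V a y b E \<alpha> + split_sum g V a y b E \<alpha>) =
      root_sum g V [a, y] E \<alpha> + root_sum g V [b, y] E \<alpha>"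
    unfolding root_sum_def split_sum_def edge_sum_add[symmetric] by (simp only:)
  then show ?thesis by simp
qed

text \<open>Avoiding both edges would isolate \<open>b\<close>, which is not a root; with exactly
  one of them \<open>b\<close> is a leaf and can be contracted. So the two variables enter only
  through their sum.\<close>

lemma root_sum_degree2:
  assumes "finite E" and E: "\<And>e. e \<in> E \<Longrightarrow> b \<notin> g e"
    and e: "g e4 = {b, b4}" "g e5 = {b, b5}" "e4 \<noteq> e5"
    and V: "b4 \<in> V" "b5 \<in> V" "b \<notin> V" "b \<notin> set R"
  shows "root_sum g (insert b V) R (insert e4 (insert e5 E)) \<alpha> =
    (\<alpha> e4 + \<alpha> e5) * root_sum g V R E \<alpha> +
    edge_sum E (\<lambda>F. of_bool (rooted_forest g (insert b V) R (insert e4 (insert e5 F)))) \<alpha>"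
proof -
  have nE: "e4 \<notin> E" "e5 \<notin> E" using E e by blast+
  have iso: "e \<in> F \<Longrightarrow> b \<notin> g e" if "F \<subseteq> E" for F e using E that by blast
  have "edge_sum E (\<lambda>F. of_bool (rooted_forest g (insert b V) R F)) \<alpha> = edge_sum E (\<lambda>F. 0) \<alpha>"
    using rooted_forest_isolated(1)[of _ b g R V] iso V by (intro edge_sum_cong) auto
  moreover have "edge_sum E (\<lambda>F. of_bool (rooted_forest g (insert b V) R (insert e4 F))) \<alpha> = root_sum g V R E \<alpha>"
    unfolding root_sum_def
    by (intro edge_sum_cong arg_cong[of _ _ of_bool] rooted_forest_pendant(1)[of _ b g e4 b4, OF iso e(1) V(1,3,4)])
  moreover have "edge_sum E (\<lambda>F. of_bool (rooted_forest g (insert b V) R (insert e5 F))) \<alpha> = root_sum g V R E \<alpha>"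
    unfolding root_sum_def
    by (intro edge_sum_cong arg_cong[of _ _ of_bool] rooted_forest_pendant(1)[of _ b g e5 b5, OF iso e(2) V(2,3,4)])
  ultimately show ?thesis
    unfolding root_sum_def[of g "insert b V"] edge_sum_insert2[OF assms(1) nE e(3)]
    by (simp add: algebra_simps)
qed

text \<open>Disposes of the common zeros of the tree sum and a single 2-forest sum, by means of a
  vertex of degree 2 that is a root of neither.\<close>

lemma root_sum_pair_dvd:
  assumes "prime q" "finite E" and E: "\<And>e. e \<in> E \<Longrightarrow> b \<notin> g e"
    and e: "g e4 = {b, b4}" "g e5 = {b, b5}" "e4 \<noteq> e5"
    and V: "b4 \<in> V" "b5 \<in> V" "b \<notin> V" "b \<notin> set R" "b \<notin> set R'"
  shows "q dvd (\<Sum>\<alpha>\<in>insert e4 (insert e5 E) \<rightarrow>\<^sub>E {0..<q}.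
    zero_mod q (root_sum g (insert b V) R (insert e4 (insert e5 E)) \<alpha>) *
    zero_mod q (root_sum g (insert b V) R' (insert e4 (insert e5 E)) \<alpha>))"
proof -
  have nE: "e4 \<notin> insert e5 E" "e4 \<notin> E" "e5 \<notin> E" using E e by blast+
  define K where "K = (\<lambda>R \<alpha>. edge_sum E (\<lambda>F. of_bool (rooted_forest g (insert b V) R (insert e4 (insert e5 F)))) \<alpha> :: int)"
  have r: "root_sum g (insert b V) R (insert e4 (insert e5 E)) (\<alpha>(e5 := x, e4 := y)) =
      (x + y) * root_sum g V R E \<alpha> + K R \<alpha>" if "b \<notin> set R" for R \<alpha> x y
    using root_sum_degree2[of E b g e4 b4 e5 b5 V R, OF assms(2) E e V(1,2,3) that] nE e(3)
    by (simp add: K_def add.commute)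
  show ?thesis
    unfolding sum_PiE_insert[OF nE(1)] sum_PiE_insert[OF nE(3)] r[OF V(4)] r[OF V(5)]
    by (rule dvd_sum, rule sum_pair_zeros_dvd[OF assms(1)])
qed

text \<open>Here \<open>b\<close> is a root: a forest using only \<open>e5\<close> makes
  \<open>b\<close> a leaf at \<open>b5\<close>, which becomes the root, and keeps the factor
  \<open>\<alpha> e4\<close>. In contrast to \<open>root_sum_degree2\<close>, the two coefficients
  may differ.\<close>

lemma split_sum_degree2:
  assumes "finite E" and E: "\<And>e. e \<in> E \<Longrightarrow> b \<notin> g e"
    and e: "g e4 = {b, b4}" "g e5 = {b, b5}" "e4 \<noteq> e5"
    and V: "b4 \<in> V" "b5 \<in> V" "b \<notin> V" "y \<in> V" "u \<in> V"
  shows "split_sum g (insert b V) b y u (insert e4 (insert e5 E)) \<alpha> =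
    \<alpha> e4 * split_sum g V b5 y u E \<alpha> + \<alpha> e5 * split_sum g V b4 y u E \<alpha> +
    edge_sum E (\<lambda>F. of_bool (rooted_forest g (insert b V) [b, y] (insert e4 (insert e5 F)) \<and>
      conn g (insert e4 (insert e5 F)) b u)) \<alpha>"
proof -
  have nE: "e4 \<notin> E" "e5 \<notin> E" using E e by blast+
  have n: "y \<noteq> b" "u \<noteq> b" using V by auto
  have iso: "e \<in> F \<Longrightarrow> b \<notin> g e" if "F \<subseteq> E" for F e using E that by blast
  have "edge_sum E (\<lambda>F. of_bool (rooted_forest g (insert b V) [b, y] F \<and> conn g F b u)) \<alpha> = edge_sum E (\<lambda>F. 0) \<alpha>"
    using conn_isolated[of _ b g u] iso n by (intro edge_sum_cong) auto
  moreover have P: "edge_sum E (\<lambda>F. of_bool (rooted_forest g (insert b V) [b, y] (insert e F) \<and>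
      conn g (insert e F) b u)) \<alpha> = split_sum g V b' y u E \<alpha>" if e: "g e = {b, b'}" "b' \<in> V" for e b'
    unfolding split_sum_def
  proof (intro edge_sum_cong arg_cong[of _ _ of_bool])
    fix F assume F: "F \<subseteq> E"
    show "(rooted_forest g (insert b V) [b, y] (insert e F) \<and> conn g (insert e F) b u) =
      (rooted_forest g V [b', y] F \<and> conn g F b' u)"
      using rooted_forest_pendant(2)[of F b g e b' V "[y]", OF iso[OF F] e(1) e(2) V(3)]
        conn_pendant(1)[of F b g e b' u, OF iso[OF F] e(1)] n by auto
  qed
  ultimately show ?thesis
    unfolding split_sum_def[of g "insert b V"] edge_sum_insert2[OF assms(1) nE e(3)] P[OF e(1) V(1)] P[OF e(2) V(2)]
    by (simp add: algebra_simps)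
qed

text \<open>This is what makes the result of eliminating both \<open>a\<close> and \<open>b\<close> independent of \<open>y\<close>.\<close>

lemma split_sum_exchange:
  assumes "y \<in> V" "u \<in> V" "u' \<in> V" "c \<in> V" "d \<in> V"
  shows "(split_sum g V c y u E \<alpha> - split_sum g V c y u' E \<alpha>) -
      (split_sum g V d y u E \<alpha> - split_sum g V d y u' E \<alpha>) =
    split_sum g V c d u E \<alpha> - split_sum g V c d u' E \<alpha>"
  unfolding split_sum_def edge_sum_diff[symmetric]
proof (intro edge_sum_cong)
  fix F
  note s = conn_commute[of g F]
  have eq: "rooted_forest g V [r, x] F \<longleftrightarrow> rooted_forest g V [r', x] F" if "conn g F r r'" for r r' x
    using split_forest_swap[of g V r x F r'] that s[of r r'] by blast
  have eqc: "conn g F r z \<longleftrightarrow> conn g F r' z" if "conn g F r r'" for r r' z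
    using that conn_trans conn_sym by metis
  have notr: "\<not> rooted_forest g V [r, x] F" if "conn g F r x" for r x
    using that by (simp add: rooted_forest_def)
  show "of_bool (rooted_forest g V [c, y] F \<and> conn g F c u) - of_bool (rooted_forest g V [c, y] F \<and> conn g F c u') -
      (of_bool (rooted_forest g V [d, y] F \<and> conn g F d u) - of_bool (rooted_forest g V [d, y] F \<and> conn g F d u')) =
      (of_bool (rooted_forest g V [c, d] F \<and> conn g F c u) - of_bool (rooted_forest g V [c, d] F \<and> conn g F c u') :: int)"
  proof (cases "conn g F c d")
    case True
    then show ?thesis using eq[OF True] eqc[OF True] notr[OF True] by simp
  next
    case ncd: False
    show ?thesis
    proof (cases "conn g F d y")
      case True
      then have "rooted_forest g V [c, y] F \<longleftrightarrow> rooted_forest g V [c, d] F"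
        using eq[OF True, of c] rooted_forest_swap by metis
      then show ?thesis using notr[OF True] by simp
    next
      case ndy: False
      show ?thesis
      proof (cases "conn g F c y")
        case True
        then have r: "rooted_forest g V [d, y] F \<longleftrightarrow> rooted_forest g V [c, d] F"
          using eq[OF True, of d] rooted_forest_swap by metis
        \<comment> \<open>With only two components, lying with \<open>d\<close> is the opposite of
          lying with \<open>c\<close>; a difference taken over \<open>u\<close> and
          \<open>u'\<close> then merely changes its sign.\<close>
        have "conn g F d z \<longleftrightarrow> \<not> conn g F c z" if "rooted_forest g V [c, d] F" "z \<in> V" for z
          using that ncd conn_trans conn_sym unfolding rooted_forest_def
          by (metis empty_iff empty_set insert_iff list.simps(15))
        then show ?thesis using r notr[OF True] assms(2,3) by (cases "rooted_forest g V [c, d] F") auto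
      next
        case ncy: False
        have n: "\<not> conn g F y d" "\<not> conn g F y c" "\<not> conn g F d c" using ncd ndy ncy s by blast+
        then have "\<not> rooted_forest g V [c, y] F" "\<not> rooted_forest g V [d, y] F" "\<not> rooted_forest g V [c, d] F"
          using ncd ncy ndy assms by (auto simp: rooted_forest_def)
        then show ?thesis by simp
      qed
    qed
  qed
qed

section \<open>Counting common zeros and eliminating vertices\<close>

definition zero_count :: "int \<Rightarrow> ('e \<Rightarrow> 'v set) \<Rightarrow> 'v set \<Rightarrow> 'e set \<Rightarrow> 'v \<Rightarrow> 'v \<Rightarrow> 'v \<Rightarrow> int" where
  "zero_count q g V E a b y = (\<Sum>\<alpha>\<in>E \<rightarrow>\<^sub>E {0..<q}. zero_mod q (root_sum g V [y] E \<alpha>) *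
     zero_mod q (root_sum g V [a, y] E \<alpha>) * zero_mod q (root_sum g V [b, y] E \<alpha>))"

definition split_count :: "int \<Rightarrow> ('e \<Rightarrow> 'v set) \<Rightarrow> 'v set \<Rightarrow> 'e set \<Rightarrow> 'v \<Rightarrow> 'v \<Rightarrow> 'v \<Rightarrow> int" where
  "split_count q g V E a b y = (\<Sum>\<alpha>\<in>E \<rightarrow>\<^sub>E {0..<q}. zero_mod q (root_sum g V [y] E \<alpha>) *
     zero_mod q (split_sum g V a y b E \<alpha>))"

lemma zero_count_commute: "zero_count q g V E a b y = zero_count q g V E b a y"
  by (simp add: zero_count_def mult_ac)

text \<open>In the two variables at \<open>a\<close> the tree sum depends on their sum only, while
  the split sum has two separate slopes. By \<open>sum_pair_zeros_cong\<close> the difference of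
  these slopes survives.\<close>

lemma split_count_remove_vertex:
  assumes "prime q" "finite E" and E: "\<And>e. e \<in> E \<Longrightarrow> a \<notin> g e"
    and e: "g e4 = {a, a4}" "g e5 = {a, a5}" "e4 \<noteq> e5"
    and V: "a4 \<in> V" "a5 \<in> V" "a \<notin> V" "y \<in> V" "b \<in> V"
  shows "[split_count q g (insert a V) (insert e4 (insert e5 E)) a b y =
    (\<Sum>\<alpha>\<in>E \<rightarrow>\<^sub>E {0..<q}. nonzero_mod q (root_sum g V [y] E \<alpha>) *
      nonzero_mod q (split_sum g V b y a4 E \<alpha> - split_sum g V b y a5 E \<alpha>))] (mod q)"
proof -
  have nE: "e4 \<notin> insert e5 E" "e4 \<notin> E" "e5 \<notin> E" using E e by blast+
  have y: "a \<notin> set [y]" using V by auto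
  define K where "K = edge_sum E (\<lambda>F. of_bool (rooted_forest g (insert a V) [y] (insert e4 (insert e5 F))) :: int)"
  define L where "L = edge_sum E (\<lambda>F. of_bool (rooted_forest g (insert a V) [a, y] (insert e4 (insert e5 F)) \<and>
      conn g (insert e4 (insert e5 F)) a b) :: int)"
  have r: "root_sum g (insert a V) [y] (insert e4 (insert e5 E)) (\<alpha>(e5 := x, e4 := z)) =
      (x + z) * root_sum g V [y] E \<alpha> + K \<alpha>" for \<alpha> x z
    using root_sum_degree2[of E a g e4 a4 e5 a5 V "[y]", OF assms(2) E e V(1,2,3) y] nE e(3)
    by (simp add: K_def add.commute)
  \<comment> \<open>\<open>split_sum_swap\<close> makes \<open>b\<close> the root instead of
    \<open>a4\<close> and \<open>a5\<close>, so that \<open>b\<close> can be eliminated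
    next.\<close>
  have t: "split_sum g (insert a V) a y b (insert e4 (insert e5 E)) (\<alpha>(e5 := x, e4 := z)) =
      z * split_sum g V b y a5 E \<alpha> + x * split_sum g V b y a4 E \<alpha> + L \<alpha>" for \<alpha> x z
    using split_sum_degree2[of E a g e4 a4 e5 a5 V y b, OF assms(2) E e V] nE e(3)
    by (simp add: L_def split_sum_swap[of g V b])
  show ?thesis
    unfolding split_count_def sum_PiE_insert[OF nE(1)] sum_PiE_insert[OF nE(3)] r t
    by (rule cong_sum, rule sum_pair_zeros_cong[OF assms(1)])
qed

text \<open>The second elimination, of the same kind with nonzeros. The difference of slopes is the
  left-hand side of \<open>split_sum_exchange\<close>, so that \<open>y\<close> remains only as the
  root of a tree sum, where it may be replaced by any other vertex.\<close>

lemma split_difference_remove_vertex: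
  assumes "prime q" "finite E" and E: "\<And>e. e \<in> E \<Longrightarrow> b \<notin> g e"
    and e: "g e4 = {b, b4}" "g e5 = {b, b5}" "e4 \<noteq> e5"
    and V: "b4 \<in> V" "b5 \<in> V" "b \<notin> V" "y \<in> V" "u \<in> V" "u' \<in> V"
  shows "[(\<Sum>\<alpha>\<in>insert e4 (insert e5 E) \<rightarrow>\<^sub>E {0..<q}.
      nonzero_mod q (root_sum g (insert b V) [y] (insert e4 (insert e5 E)) \<alpha>) *
      nonzero_mod q (split_sum g (insert b V) b y u (insert e4 (insert e5 E)) \<alpha> -
        split_sum g (insert b V) b y u' (insert e4 (insert e5 E)) \<alpha>)) =
    (\<Sum>\<alpha>\<in>E \<rightarrow>\<^sub>E {0..<q}. nonzero_mod q (root_sum g V [y] E \<alpha>) *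
      nonzero_mod q (split_sum g V b4 b5 u E \<alpha> - split_sum g V b4 b5 u' E \<alpha>))] (mod q)"
proof -
  have nE: "e4 \<notin> insert e5 E" "e4 \<notin> E" "e5 \<notin> E" using E e by blast+
  have y: "b \<notin> set [y]" using V by auto
  define K where "K = edge_sum E (\<lambda>F. of_bool (rooted_forest g (insert b V) [y] (insert e4 (insert e5 F))) :: int)"
  define L where "L = (\<lambda>u. edge_sum E (\<lambda>F. of_bool (rooted_forest g (insert b V) [b, y] (insert e4 (insert e5 F)) \<and>
      conn g (insert e4 (insert e5 F)) b u) :: int))"
  have r: "root_sum g (insert b V) [y] (insert e4 (insert e5 E)) (\<alpha>(e5 := x, e4 := z)) =
      (x + z) * root_sum g V [y] E \<alpha> + K \<alpha>" for \<alpha> x z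
    using root_sum_degree2[of E b g e4 b4 e5 b5 V "[y]", OF assms(2) E e V(1,2,3) y] nE e(3)
    by (simp add: K_def add.commute)
  have t: "split_sum g (insert b V) b y u (insert e4 (insert e5 E)) (\<alpha>(e5 := x, e4 := z)) =
      z * split_sum g V b5 y u E \<alpha> + x * split_sum g V b4 y u E \<alpha> + L u \<alpha>" if "u \<in> V" for \<alpha> x z u
    using split_sum_degree2[of E b g e4 b4 e5 b5 V y u, OF assms(2) E e V(1-4) that] nE e(3)
    by (simp add: L_def)
  have d: "split_sum g (insert b V) b y u (insert e4 (insert e5 E)) (\<alpha>(e5 := x, e4 := z)) -
      split_sum g (insert b V) b y u' (insert e4 (insert e5 E)) (\<alpha>(e5 := x, e4 := z)) =
      z * (split_sum g V b5 y u E \<alpha> - split_sum g V b5 y u' E \<alpha>) +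
      x * (split_sum g V b4 y u E \<alpha> - split_sum g V b4 y u' E \<alpha>) + (L u \<alpha> - L u' \<alpha>)" for \<alpha> x z
    unfolding t[OF V(5)] t[OF V(6)] by (simp add: algebra_simps)
  show ?thesis
    unfolding sum_PiE_insert[OF nE(1)] sum_PiE_insert[OF nE(3)] r d
      split_sum_exchange[OF V(4,5,6,1,2), symmetric]
    by (rule cong_sum, rule sum_pair_nonzeros_cong[OF assms(1)])
qed

text \<open>Serves for an edge between \<open>a\<close> and \<open>b\<close>: once \<open>a\<close>
  is removed, \<open>b\<close> is a leaf and is itself one of the two vertices compared. Forests
  without \<open>e4\<close> isolate \<open>b\<close> and contribute only to the term for
  \<open>b\<close>, so the variable of \<open>e4\<close> has the remaining tree sum as its
  coefficient.\<close>

lemma split_difference_remove_leaf: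
  assumes "prime q" "finite E" and E: "\<And>e. e \<in> E \<Longrightarrow> b \<notin> g e"
    and e: "g e4 = {b, b4}" and V: "b4 \<in> V" "b \<notin> V" "y \<in> V" "u \<in> V"
  shows "[(\<Sum>\<alpha>\<in>insert e4 E \<rightarrow>\<^sub>E {0..<q}.
      nonzero_mod q (root_sum g (insert b V) [y] (insert e4 E) \<alpha>) *
      nonzero_mod q (split_sum g (insert b V) b y b (insert e4 E) \<alpha> -
        split_sum g (insert b V) b y u (insert e4 E) \<alpha>)) =
    (\<Sum>\<alpha>\<in>E \<rightarrow>\<^sub>E {0..<q}. - nonzero_mod q (root_sum g V [y] E \<alpha>))] (mod q)"
proof -
  have nE: "e4 \<notin> E" using E e by blast+
  have n: "y \<noteq> b" "u \<noteq> b" "b \<notin> set [y]" using V by auto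
  have iso: "e \<in> F \<Longrightarrow> b \<notin> g e" if "F \<subseteq> E" for F e using E that by blast
  define K where "K = (\<lambda>u. edge_sum E (\<lambda>F. of_bool (rooted_forest g (insert b V) [b, y] (insert e4 F) \<and>
      conn g (insert e4 F) b u) :: int))"
  have r: "root_sum g (insert b V) [y] (insert e4 E) \<alpha> = root_sum g V [y] E \<alpha>" for \<alpha>
  proof -
    have "edge_sum E (\<lambda>F. of_bool (rooted_forest g (insert b V) [y] F)) \<alpha> = edge_sum E (\<lambda>F. 0) \<alpha>"
      using rooted_forest_isolated(1)[of _ b g "[y]" V] iso n by (intro edge_sum_cong) auto
    moreover have "edge_sum E (\<lambda>F. of_bool (rooted_forest g (insert b V) [y] (insert e4 F))) \<alpha> = root_sum g V [y] E \<alpha>"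
      unfolding root_sum_def
      by (intro edge_sum_cong arg_cong[of _ _ of_bool] rooted_forest_pendant(1)[of _ b g e4 b4, OF iso e V(1,2) n(3)])
    ultimately show ?thesis unfolding root_sum_def[of g "insert b V"] edge_sum_insert[OF assms(2) nE] by simp
  qed
  have u: "split_sum g (insert b V) b y u (insert e4 E) \<alpha> = K u \<alpha>" for \<alpha>
  proof -
    have "edge_sum E (\<lambda>F. of_bool (rooted_forest g (insert b V) [b, y] F \<and> conn g F b u)) \<alpha> = edge_sum E (\<lambda>F. 0) \<alpha>"
      using conn_isolated[of _ b g u] iso n by (intro edge_sum_cong) auto
    then show ?thesis unfolding split_sum_def edge_sum_insert[OF assms(2) nE] K_def by simp
  qed
  have b: "split_sum g (insert b V) b y b (insert e4 E) \<alpha> = \<alpha> e4 * root_sum g V [y] E \<alpha> + K b \<alpha>" for \<alpha>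
  proof -
    have "edge_sum E (\<lambda>F. of_bool (rooted_forest g (insert b V) [b, y] F \<and> conn g F b b)) \<alpha> = root_sum g V [y] E \<alpha>"
      unfolding root_sum_def using rooted_forest_isolated(2)[of _ b g "[y]" V] iso n V(2)
      by (intro edge_sum_cong) auto
    then show ?thesis unfolding split_sum_def edge_sum_insert[OF assms(2) nE] K_def by simp
  qed
  have d: "split_sum g (insert b V) b y b (insert e4 E) (\<alpha>(e4 := x)) -
      split_sum g (insert b V) b y u (insert e4 E) (\<alpha>(e4 := x)) =
      root_sum g V [y] E \<alpha> * x + (K b \<alpha> - K u \<alpha>)" for \<alpha> x
    using nE unfolding b u by (simp add: K_def)
  have "[(\<Sum>x\<in>{0..<q}. nonzero_mod q t * nonzero_mod q (t * x + c)) = - nonzero_mod q t] (mod q)" for t c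
  proof -
    have "[nonzero_mod q t * (\<Sum>x\<in>{0..<q}. nonzero_mod q (t * x + c)) = nonzero_mod q t * - nonzero_mod q t] (mod q)"
      by (intro cong_mult cong_refl sum_affine_nonzeros_cong assms(1))
    moreover have "nonzero_mod q t * - nonzero_mod q t = - nonzero_mod q t" by (simp add: nonzero_mod_def)
    ultimately show ?thesis by (simp only: sum_distrib_left)
  qed
  then show ?thesis
    unfolding sum_PiE_insert[OF nE] r d using nE by (intro cong_sum) simp
qed

section \<open>Independence of the fourth neighbour\<close>

definition graph_on :: "('e \<Rightarrow> 'v set) \<Rightarrow> 'v set \<Rightarrow> 'e set \<Rightarrow> bool" where
  "graph_on g V E \<longleftrightarrow> finite V \<and> finite E \<and> (\<forall>e\<in>E. \<exists>x\<in>V. \<exists>y\<in>V. g e = {x, y})"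

text \<open>The far ends \<open>a4\<close> and \<open>a5\<close> may coincide, so a double edge is
  included, whereas a loop is not.\<close>

definition two_edges_at :: "('e \<Rightarrow> 'v set) \<Rightarrow> 'e set \<Rightarrow> 'v \<Rightarrow> 'e \<Rightarrow> 'v \<Rightarrow> 'e \<Rightarrow> 'v \<Rightarrow> bool" where
  "two_edges_at g E a e4 a4 e5 a5 \<longleftrightarrow> {e \<in> E. a \<in> g e} = {e4, e5} \<and> e4 \<noteq> e5 \<and>
     g e4 = {a, a4} \<and> g e5 = {a, a5} \<and> a4 \<noteq> a \<and> a5 \<noteq> a"

lemma graph_on_ends:
  assumes "graph_on g V E" "e \<in> E" "g e = {x, y}"
  shows "x \<in> V" "y \<in> V"
  using assms unfolding graph_on_def by (metis doubleton_eq_iff)+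

lemma two_edges_at_remove:
  assumes "graph_on g V E" "two_edges_at g E a e4 a4 e5 a5" "a \<in> V"
  obtains V' E' where "V = insert a V'" "a \<notin> V'" "a4 \<in> V'" "a5 \<in> V'"
    "E = insert e4 (insert e5 E')" "\<forall>e\<in>E'. a \<notin> g e" "finite E'"
    "E' = {e \<in> E. a \<notin> g e}" "V' = V - {a}" "graph_on g V' E'"
proof -
  define E' where "E' = {e \<in> E. a \<notin> g e}"
  have e: "e4 \<in> E" "e5 \<in> E" "g e4 = {a, a4}" "g e5 = {a, a5}" "a4 \<noteq> a" "a5 \<noteq> a"
    and Ea: "{e \<in> E. a \<in> g e} = {e4, e5}"
    using assms(2) unfolding two_edges_at_def by auto
  have 1: "E = insert e4 (insert e5 E')" unfolding E'_def using Ea e by auto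
  have 2: "a4 \<in> V" "a5 \<in> V" using graph_on_ends[OF assms(1)] e by blast+
  have "\<exists>x\<in>V - {a}. \<exists>y\<in>V - {a}. g e = {x, y}" if "e \<in> E'" for e
    using that assms(1) unfolding E'_def graph_on_def by fastforce
  then have 3: "graph_on g (V - {a}) E'"
    using assms(1) unfolding graph_on_def E'_def by auto
  show ?thesis
    by (rule that[of "V - {a}" E', OF _ _ _ _ 1 _ _ E'_def refl 3])
      (use 2 3 e(5,6) assms(3) in \<open>auto simp: E'_def graph_on_def\<close>)
qed

text \<open>If \<open>T\<close> vanishes, then the split sum vanishes iff one of the two 2-forest sums does.\<close>

lemma zero_count_split:
  assumes "prime q" and G: "graph_on g V E" and ab: "a \<in> V" "b \<in> V" "a \<noteq> b"
    and a: "two_edges_at g E a e4 a4 e5 a5" and b: "two_edges_at g E b f4 b4 f5 b5"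
    and y: "y \<in> V" "y \<noteq> a" "y \<noteq> b"
  shows "[zero_count q g V E a b y = - split_count q g V E a b y] (mod q)"
proof -
  let ?S = "E \<rightarrow>\<^sub>E {0..<q}"
  let ?T = "\<lambda>\<alpha>. zero_mod q (root_sum g V [y] E \<alpha>)"
  have fin: "finite E" "finite V" "\<And>e. e \<in> E \<Longrightarrow> \<exists>x\<in>V. \<exists>y\<in>V. g e = {x, y}"
    using G by (auto simp: graph_on_def)
  have "?T \<alpha> * zero_mod q (root_sum g V [a, y] E \<alpha>) * zero_mod q (root_sum g V [b, y] E \<alpha>) =
      ?T \<alpha> * zero_mod q (root_sum g V [a, y] E \<alpha>) + ?T \<alpha> * zero_mod q (root_sum g V [b, y] E \<alpha>) -
      ?T \<alpha> * zero_mod q (split_sum g V a y b E \<alpha>)" for \<alpha>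
  proof (cases "q dvd root_sum g V [y] E \<alpha>")
    case True
    have q0: "int (nat q) = q" "nat q > 0" using prime_gt_0_int[OF assms(1)] by auto
    have "q dvd root_sum g V [y] E \<alpha> * root_sum g V [b, a, y] E \<alpha>" using True by simp
    then have "q dvd root_sum g V [a, y] E \<alpha> * root_sum g V [b, y] E \<alpha> - (split_sum g V a y b E \<alpha>)\<^sup>2"
      using edge_sum_identity[of E V g a b y "nat q" \<alpha>, OF fin ab(1,2) y(1) q0(2)] unfolding q0 root_sum_def split_sum_def
      using cong_dvd_iff by blast
    then have "q dvd root_sum g V [a, y] E \<alpha> * root_sum g V [b, y] E \<alpha> \<longleftrightarrow> q dvd (split_sum g V a y b E \<alpha>)\<^sup>2"
      by (metis dvd_diff_right_iff dvd_diff_left_iff)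
    then have "q dvd root_sum g V [a, y] E \<alpha> \<or> q dvd root_sum g V [b, y] E \<alpha> \<longleftrightarrow> q dvd split_sum g V a y b E \<alpha>"
      using assms(1) by (simp add: prime_dvd_mult_iff prime_dvd_power_iff)
    then show ?thesis by (auto simp: zero_mod_def)
  qed (simp add: zero_mod_def)
  then have "zero_count q g V E a b y =
      (\<Sum>\<alpha>\<in>?S. ?T \<alpha> * zero_mod q (root_sum g V [a, y] E \<alpha>)) +
      (\<Sum>\<alpha>\<in>?S. ?T \<alpha> * zero_mod q (root_sum g V [b, y] E \<alpha>)) - split_count q g V E a b y"
    unfolding zero_count_def split_count_def sum.distrib[symmetric] sum_subtractf[symmetric] by (simp only:)
  \<comment> \<open>Used with \<open>u\<close> and \<open>c\<close> as the two common neighbours in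
    either order: \<open>c\<close> has degree 2 and is a root of neither sum.\<close>
  moreover have pd: "q dvd (\<Sum>\<alpha>\<in>?S. ?T \<alpha> * zero_mod q (root_sum g V [u, y] E \<alpha>))"
    if u: "u \<noteq> c" "y \<noteq> c" "c \<in> V" "two_edges_at g E c f4 c4 f5 c5" for u c f4 c4 f5 c5
  proof -
    obtain V' E' where *: "V = insert c V'" "c \<notin> V'" "c4 \<in> V'" "c5 \<in> V'"
      "E = insert f4 (insert f5 E')" "\<forall>e\<in>E'. c \<notin> g e" "finite E'"
      "E' = {e \<in> E. c \<notin> g e}" "V' = V - {c}" "graph_on g V' E'"
      by (rule two_edges_at_remove[OF G u(4,3)], rule that)
    have f: "g f4 = {c, c4}" "g f5 = {c, c5}" "f4 \<noteq> f5" using u(4) by (auto simp: two_edges_at_def)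
    have R: "c \<notin> set [y]" "c \<notin> set [u, y]" using u by auto
    show ?thesis unfolding *(1,5)
      by (rule root_sum_pair_dvd[of q E' c g f4 c4 f5 c5 V',
            OF assms(1) *(7) *(6)[rule_format] f *(3,4,2) R])
  qed
  ultimately show ?thesis
    using pd[OF ab(3) y(3) ab(2) b] pd[OF ab(3)[symmetric] y(2) ab(1) a]
    by (simp add: cong_iff_dvd_diff)
qed

text \<open>First \<open>a\<close> is eliminated, then \<open>b\<close>. The second elimination
  depends on how many of the two edges at \<open>a\<close> lead to \<open>b\<close>, since these are
  gone by then.\<close>

lemma split_count_cong:
  assumes "prime q" and G: "graph_on g V E" and ab: "a \<in> V" "b \<in> V" "a \<noteq> b"
    and a: "two_edges_at g E a e4 a4 e5 a5" and b: "two_edges_at g E b f4 b4 f5 b5"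
    and y: "y \<in> V" "y \<noteq> a" "y \<noteq> b" and x: "x \<in> V" "x \<noteq> a" "x \<noteq> b"
  shows "[split_count q g V E a b y = split_count q g V E a b x] (mod q)"
proof -
  obtain V' E' where *: "V = insert a V'" "a \<notin> V'" "a4 \<in> V'" "a5 \<in> V'"
    "E = insert e4 (insert e5 E')" "\<forall>e\<in>E'. a \<notin> g e" "finite E'"
    "E' = {e \<in> E. a \<notin> g e}" "V' = V - {a}" "graph_on g V' E'"
    by (rule two_edges_at_remove[OF G a ab(1)], rule that)
  have ea: "g e4 = {a, a4}" "g e5 = {a, a5}" "e4 \<noteq> e5" "{e \<in> E. a \<in> g e} = {e4, e5}"
    using a by (auto simp: two_edges_at_def)
  have eb: "g f4 = {b, b4}" "g f5 = {b, b5}" "f4 \<noteq> f5" "{e \<in> E. b \<in> g e} = {f4, f5}" "b4 \<noteq> b" "b5 \<noteq> b"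
    using b by (auto simp: two_edges_at_def)
  have bV: "b \<in> V'" using ab *(9) by auto
  \<comment> \<open>The count that remains after the elimination of \<open>a\<close>, with the
    vertices compared and the root as parameters.\<close>
  define D where "D = (\<lambda>u u' z. \<Sum>\<alpha>\<in>E' \<rightarrow>\<^sub>E {0..<q}. nonzero_mod q (root_sum g V' [z] E' \<alpha>) *
      nonzero_mod q (split_sum g V' b z u E' \<alpha> - split_sum g V' b z u' E' \<alpha>))"
  have D: "[split_count q g V E a b z = D a4 a5 z] (mod q)" if "z \<in> V'" for z
    unfolding D_def *(1,5) by (rule split_count_remove_vertex[of q E' a g e4 a4 e5 a5 V' z b, OF assms(1) *(7) *(6)[rule_format] ea(1-3) *(3,4,2) that bV])
  have Dsym: "D u u' z = D u' u z" for u u' z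
    unfolding D_def nonzero_mod_def by (simp add: dvd_diff_commute)
  have xy: "x \<in> V' - {b}" "y \<in> V' - {b}" using x y *(9) by auto
  define W where "W = V' - {b}"
  have W: "V' = insert b W" "b \<notin> W" "x \<in> W" "y \<in> W" using bV xy by (auto simp: W_def)
  \<comment> \<open>Exactly one edge \<open>e\<close> at \<open>a\<close> leads to \<open>b\<close>;
    the other one is \<open>e'\<close>. So \<open>b\<close> keeps a single edge \<open>f\<close>,
    with far end \<open>c\<close>.\<close>
  have leaf: "[D b u z = D b u z'] (mod q)"
    if h: "e \<in> E" "g e = {a, b}" "u \<in> W" "e' \<in> E" "b \<notin> g e'" "a \<in> g e'" "{e4, e5} = {e, e'}"
      "z \<in> W" "z' \<in> W" for e e' u z z'
  proof -
    have "e \<in> {f4, f5}" using h(1,2) eb(4) by auto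
    then obtain f c where f: "{f4, f5} = {e, f}" "f \<noteq> e" "g f = {b, c}" "c \<noteq> b" using eb by auto
    have fE: "f \<in> E" "b \<in> g f" using f eb(4) by auto
    have fa: "a \<notin> g f"
    proof
      assume "a \<in> g f"
      then have "f \<in> {e, e'}" using fE ea(4) h(7) by auto
      then show False using f(2) fE(2) h(5) by auto
    qed
    define E'' where "E'' = E' - {f}"
    have E'': "E' = insert f E''" using fE fa *(8) by (auto simp: E''_def)
    have c: "c \<in> W" using graph_on_ends(2)[OF *(10), of f b c] f(3,4) E'' by (auto simp: W_def)
    have iso: "d \<in> E'' \<Longrightarrow> b \<notin> g d" for d
    proof
      assume d: "d \<in> E''" "b \<in> g d"
      then have "d \<in> {f4, f5}" "a \<notin> g d" using eb(4) *(8) by (auto simp: E''_def)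
      then show False using f(1) d h(2) by (auto simp: E''_def)
    qed
    have fin: "finite E''" using *(7) by (simp add: E''_def)
    have Dv: "[D b u v = (\<Sum>\<alpha>\<in>E'' \<rightarrow>\<^sub>E {0..<q}. - nonzero_mod q (root_sum g W [v] E'' \<alpha>))] (mod q)" if "v \<in> W" for v
      unfolding D_def E'' W(1) by (rule split_difference_remove_leaf[of q E'' b g f c W v u, OF assms(1) fin iso f(3) c W(2) that h(3)])
    have "root_sum g W [z] E'' = root_sum g W [z'] E''"
      using root_sum_single_cong[OF h(8,9)] by blast
    then show ?thesis
      using cong_trans[OF Dv[OF h(8)]] cong_sym[OF Dv[OF h(9)]] by (simp only:)
  qed
  have "[D a4 a5 y = D a4 a5 x] (mod q)"
  proof (cases "a4 = b")
    case True
    show ?thesis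
    proof (cases "a5 = b")
      case True
      \<comment> \<open>A double edge between \<open>a\<close> and \<open>b\<close>:
        \<open>b\<close> is compared with itself, the difference vanishes identically and both
        counts are 0.\<close>
      then show ?thesis using \<open>a4 = b\<close> by (simp add: D_def nonzero_mod_def)
    next
      case False
      then show ?thesis using leaf[of e4 a5 e5 y x] True ea *(4) W ab by (auto simp: *(5))
    qed
  next
    case n4: False
    show ?thesis
    proof (cases "a5 = b")
      case True
      then have "[D a5 a4 y = D a5 a4 x] (mod q)"
        using leaf[of e5 a4 e4 y x] n4 ea *(3) W ab by (auto simp: *(5))
      then show ?thesis using Dsym by metis
    next
      case n5: False
      have u: "a4 \<in> W" "a5 \<in> W" using n4 n5 *(3,4) by (auto simp: W_def)
      have fE: "f4 \<in> E'" "f5 \<in> E'"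
      proof -
        have fE: "f4 \<in> E" "f5 \<in> E" using eb(4) by auto
        have "f4 \<notin> {e4, e5}" "f5 \<notin> {e4, e5}" using eb ea n4 n5 ab(3) by auto
        then have "a \<notin> g f4" "a \<notin> g f5" using ea(4) fE by blast+
        then show "f4 \<in> E'" "f5 \<in> E'" using fE *(8) by auto
      qed
      define E'' where "E'' = E' - {f4, f5}"
      have E'': "E' = insert f4 (insert f5 E'')" using fE by (auto simp: E''_def)
      have iso: "d \<in> E'' \<Longrightarrow> b \<notin> g d" for d using eb(4) *(8) by (auto simp: E''_def)
      have fin: "finite E''" using *(7) by (simp add: E''_def)
      have c: "b4 \<in> W" "b5 \<in> W" using graph_on_ends(2)[OF *(10)] fE eb by (auto simp: W_def)
      have Dv: "[D a4 a5 v = (\<Sum>\<alpha>\<in>E'' \<rightarrow>\<^sub>E {0..<q}. nonzero_mod q (root_sum g W [v] E'' \<alpha>) *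
          nonzero_mod q (split_sum g W b4 b5 a4 E'' \<alpha> - split_sum g W b4 b5 a5 E'' \<alpha>))] (mod q)" if "v \<in> W" for v
        unfolding D_def E'' W(1)
        by (rule split_difference_remove_vertex[of q E'' b g f4 b4 f5 b5 W v a4 a5, OF assms(1) fin iso eb(1-3) c W(2) that u])
      have "root_sum g W [x] E'' = root_sum g W [y] E''"
        using root_sum_single_cong[OF W(3,4)] by blast
      then show ?thesis
        using cong_trans[OF Dv[OF W(4)]] cong_sym[OF Dv[OF W(3)]] by (simp only:)
    qed
  qed
  then show ?thesis using D xy by (meson DiffD1 cong_sym cong_trans)
qed

text \<open>Needed when a fourth neighbour is itself a common neighbour, which then keeps only one
  edge. The tree sum does not involve the pendant variable, and in the other two sums its
  coefficient is 0 or the tree sum. Hence this variable is free wherever the tree sum vanishes, and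
  contributes a factor \<open>q\<close>.\<close>

lemma zero_count_leaf:
  assumes "prime q" and G: "graph_on g V E" and ab: "a \<in> V" "b \<in> V" "a \<noteq> b" and y: "y \<in> V"
    and a: "{e \<in> E. a \<in> g e} = {e}" "g e = {a, a'}" "a' \<noteq> a"
  shows "q dvd zero_count q g V E a b y"
proof -
  define E' where "E' = E - {e}"
  define V' where "V' = V - {a}"
  have e: "e \<in> E" "e \<notin> E'" using a by (auto simp: E'_def)
  have E: "E = insert e E'" using e by (auto simp: E'_def)
  have V: "V = insert a V'" "a \<notin> V'" "b \<in> V'" "a' \<in> V'"
    using ab graph_on_ends(2)[OF G e(1) a(2)] a(3) by (auto simp: V'_def)
  have fin: "finite E'" using G by (auto simp: graph_on_def E'_def)
  have iso: "d \<in> F \<Longrightarrow> a \<notin> g d" if "F \<subseteq> E'" for F d using a(1) that by (auto simp: E'_def)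
  let ?t = "\<lambda>\<alpha>. root_sum g V' [b] E' \<alpha>"
  define K where "K = (\<lambda>R. edge_sum E' (\<lambda>F. of_bool (rooted_forest g V R (insert e F)) :: int))"
  have ex: "root_sum g V R E \<alpha> = \<alpha> e * root_sum g V R E' \<alpha> + K R \<alpha>" for R \<alpha>
    unfolding root_sum_def K_def E by (rule edge_sum_insert[OF fin e(2)])
  have z: "root_sum g V R E' \<alpha> = 0" if "a \<notin> set R" for R \<alpha>
  proof -
    have "root_sum g V R E' \<alpha> = edge_sum E' (\<lambda>F. 0) \<alpha>"
      unfolding root_sum_def V(1) using rooted_forest_isolated(1)[of _ a g R V'] iso that
      by (intro edge_sum_cong) auto
    then show ?thesis by simp
  qed
  have w: "root_sum g V (a # R) E' \<alpha> = root_sum g V' R E' \<alpha>" if "a \<notin> set R" for R \<alpha>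
    unfolding root_sum_def V(1) using rooted_forest_isolated(2)[of _ a g R V'] iso that V(2)
    by (intro edge_sum_cong) auto
  have nil: "root_sum g V' [] E' \<alpha> = 0" for \<alpha>
  proof -
    have "V' \<noteq> {}" using V(3) by auto
    then show ?thesis by (simp add: root_sum_def edge_sum_def rooted_forest_def)
  qed
  have aa: "root_sum g V [a, a] E' \<alpha> = 0" for \<alpha>
    by (simp add: root_sum_def edge_sum_def rooted_forest_def)
  have T0: "root_sum g V [y] E' \<alpha> = 0" for \<alpha>
    using z[of "[y]"] w[of "[]"] nil by (cases "y = a") auto
  have KT: "K [y] \<alpha> = ?t \<alpha>" for \<alpha>
  proof (cases "y = a")
    case True
    have "K [y] \<alpha> = root_sum g V' [a'] E' \<alpha>"
      unfolding K_def root_sum_def V(1) True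
      by (intro edge_sum_cong arg_cong[of _ _ of_bool] rooted_forest_pendant(2)[of _ a g e a', OF iso a(2) V(4,2)]) auto
    then show ?thesis using root_sum_single_cong V(3,4) by metis
  next
    case False
    then have "K [y] \<alpha> = root_sum g V' [y] E' \<alpha>"
      unfolding K_def root_sum_def V(1)
      by (intro edge_sum_cong arg_cong[of _ _ of_bool] rooted_forest_pendant(1)[of _ a g e a', OF iso a(2) V(4,2)]) auto
    moreover have "y \<in> V'" using y False by (simp add: V'_def)
    ultimately show ?thesis using root_sum_single_cong V(3) by metis
  qed
  have T: "root_sum g V [y] E \<alpha> = ?t \<alpha>" for \<alpha> using ex[of "[y]"] T0 KT by simp
  \<comment> \<open>Without \<open>e\<close> the vertex \<open>a\<close> is isolated, so the
    coefficient is the tree sum of the rest if \<open>a\<close> occurs exactly once among the roots,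
    and 0 otherwise.\<close>
  have c1: "root_sum g V [a, y] E' \<alpha> \<in> {0, ?t \<alpha>}" for \<alpha>
  proof (cases "y = a")
    case False
    then have "y \<in> V'" using y by (simp add: V'_def)
    then show ?thesis using w[of "[y]" \<alpha>] False root_sum_single_cong[OF _ V(3), of y g E' \<alpha>] by auto
  qed (simp add: aa)
  have c2: "root_sum g V [b, y] E' \<alpha> \<in> {0, ?t \<alpha>}" for \<alpha>
  proof (cases "y = a")
    case True
    then show ?thesis using w[of "[b]" \<alpha>] ab(3) by (simp add: root_sum_swap[of g V b a])
  next
    case False
    then show ?thesis using z[of "[b, y]" \<alpha>] ab(3) by auto
  qed
  have zt: "zero_mod q t * zero_mod q (x * c + k) = zero_mod q t * zero_mod q k" if "c \<in> {0, t}" for t x c k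
  proof (cases "q dvd t")
    case True
    then have "q dvd x * c" using that by auto
    then show ?thesis by (simp add: zero_mod_def dvd_add_right_iff)
  qed (simp add: zero_mod_def)
  have upd: "K R (\<alpha>(e := x)) = K R \<alpha>" "root_sum g V R E' (\<alpha>(e := x)) = root_sum g V R E' \<alpha>" for R \<alpha> x
    using e(2) by (simp_all add: K_def)
  have main: "zero_mod q (root_sum g V [y] E (\<alpha>(e := x))) * zero_mod q (root_sum g V [a, y] E (\<alpha>(e := x))) *
      zero_mod q (root_sum g V [b, y] E (\<alpha>(e := x))) =
      zero_mod q (?t \<alpha>) * zero_mod q (K [a, y] \<alpha>) * zero_mod q (K [b, y] \<alpha>)" for \<alpha> x
  proof -
    have "zero_mod q (?t \<alpha>) * zero_mod q (x * root_sum g V [a, y] E' \<alpha> + K [a, y] \<alpha>) *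
        zero_mod q (x * root_sum g V [b, y] E' \<alpha> + K [b, y] \<alpha>) =
      zero_mod q (?t \<alpha>) * zero_mod q (K [a, y] \<alpha>) * zero_mod q (K [b, y] \<alpha>)"
      unfolding zt[OF c1[of \<alpha>]]
      by (simp only: mult.assoc mult.left_commute[of "zero_mod q (?t \<alpha>)"] zt[OF c2[of \<alpha>]])
    moreover have "?t (\<alpha>(e := x)) = ?t \<alpha>" using e(2) by simp
    ultimately show ?thesis unfolding T ex[of "[a, y]"] ex[of "[b, y]"] upd by simp
  qed
  have q0: "q > 0" using prime_gt_0_int[OF assms(1)] .
  have "zero_count q g V E a b y = (\<Sum>\<alpha>\<in>insert e E' \<rightarrow>\<^sub>E {0..<q}. zero_mod q (root_sum g V [y] E \<alpha>) *
     zero_mod q (root_sum g V [a, y] E \<alpha>) * zero_mod q (root_sum g V [b, y] E \<alpha>))"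
    unfolding zero_count_def using E by simp
  also have "\<dots> = (\<Sum>\<alpha>\<in>E' \<rightarrow>\<^sub>E {0..<q}. q * (zero_mod q (?t \<alpha>) * zero_mod q (K [a, y] \<alpha>) * zero_mod q (K [b, y] \<alpha>)))"
    unfolding sum_PiE_insert[OF e(2)] main using q0 by simp
  finally show ?thesis by (simp add: dvd_sum)
qed

text \<open>A loop lies in no forest, so its variable is a factor of every sum, and \<open>a\<close>
  is otherwise isolated. Sums without the root \<open>a\<close> vanish, and the one rooted at
  \<open>a\<close> and \<open>y\<close> becomes a tree sum of the rest, where the choice of root is
  immaterial.\<close>

lemma zero_count_loop:
  assumes G: "graph_on g V E" and ab: "a \<in> V" "b \<in> V" "a \<noteq> b"
    and xy: "x \<in> V" "y \<in> V" "x \<noteq> a" "y \<noteq> a"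
    and a: "{e \<in> E. a \<in> g e} = {e}" "g e = {a}"
  shows "zero_count q g V E a b y = zero_count q g V E a b x"
proof -
  define E' where "E' = E - {e}"
  define V' where "V' = V - {a}"
  have e: "e \<in> E" "e \<notin> E'" using a by (auto simp: E'_def)
  have E: "E = insert e E'" using e by (auto simp: E'_def)
  have V: "V = insert a V'" "a \<notin> V'" "b \<in> V'" "x \<in> V'" "y \<in> V'" using ab xy by (auto simp: V'_def)
  have fin: "finite E'" using G by (auto simp: graph_on_def E'_def)
  have iso: "d \<in> F \<Longrightarrow> a \<notin> g d" if "F \<subseteq> E'" for F d using a(1) that by (auto simp: E'_def)
  have ex: "root_sum g V R E \<alpha> = \<alpha> e * root_sum g V R E' \<alpha>" for R \<alpha>
    unfolding root_sum_def E edge_sum_insert[OF fin e(2)] using rooted_forest_loop[of g e a, OF a(2)] by simp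
  have z: "root_sum g V R E' \<alpha> = 0" if "a \<notin> set R" for R \<alpha>
  proof -
    have "root_sum g V R E' \<alpha> = edge_sum E' (\<lambda>F. 0) \<alpha>"
      unfolding root_sum_def V(1) using rooted_forest_isolated(1)[of _ a g R V'] iso that
      by (intro edge_sum_cong) auto
    then show ?thesis by simp
  qed
  have w: "root_sum g V (a # R) E' \<alpha> = root_sum g V' R E' \<alpha>" if "a \<notin> set R" for R \<alpha>
    unfolding root_sum_def V(1) using rooted_forest_isolated(2)[of _ a g R V'] iso that V(2)
    by (intro edge_sum_cong) auto
  have "zero_mod q (root_sum g V [z] E \<alpha>) * zero_mod q (root_sum g V [a, z] E \<alpha>) *
      zero_mod q (root_sum g V [b, z] E \<alpha>) = zero_mod q (\<alpha> e * root_sum g V' [b] E' \<alpha>)"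
    if zV: "z \<in> V'" for z \<alpha>
  proof -
    have "z \<noteq> a" using zV V(2) by auto
    then show ?thesis
      unfolding ex using z[of "[z]" \<alpha>] z[of "[b, z]" \<alpha>] w[of "[z]" \<alpha>] ab(3)
        root_sum_single_cong[OF zV V(3), of g E' \<alpha>]
      by (auto simp: zero_mod_def)
  qed
  then show ?thesis using V(4,5) by (simp add: zero_count_def)
qed

text \<open>The hypotheses \<open>da\<close> and \<open>db\<close> say what is left of degree 4 once
  the edges to \<open>v\<close> and \<open>w\<close> are gone. A common neighbour equal to
  \<open>x\<close> or \<open>y\<close> is a leaf; otherwise it has either a loop or two ordinary
  edges.\<close>

lemma zero_count_cong:
  assumes "prime q" and G: "graph_on g V E" and ab: "a \<in> V" "b \<in> V" "a \<noteq> b"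
    and xy: "x \<in> V" "y \<in> V" "x \<noteq> y"
    and da: "card {e \<in> E. a \<in> g e} + card {e \<in> E. g e = {a}} + of_bool (x = a) + of_bool (y = a) = 2"
    and db: "card {e \<in> E. b \<in> g e} + card {e \<in> E. g e = {b}} + of_bool (x = b) + of_bool (y = b) = 2"
  shows "[zero_count q g V E a b y = zero_count q g V E a b x] (mod q)"
proof -
  have fin: "finite E" using G by (simp add: graph_on_def)
  have nonloop: "\<exists>u'. g e = {u, u'} \<and> u' \<noteq> u" if "e \<in> E" "u \<in> g e" "g e \<noteq> {u}" for e u
  proof -
    obtain s t where "g e = {s, t}" using G \<open>e \<in> E\<close> by (auto simp: graph_on_def)
    then show ?thesis using that by (auto simp: insert_commute)
  qed
  have deg: "card {e \<in> E. g e = {u}} \<le> card {e \<in> E. u \<in> g e}" for u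
    using fin by (intro card_mono) auto
  have leaf: "\<exists>e u'. {e \<in> E. u \<in> g e} = {e} \<and> g e = {u, u'} \<and> u' \<noteq> u"
    if d: "card {e \<in> E. u \<in> g e} + card {e \<in> E. g e = {u}} = 1" for u
  proof -
    have "card {e \<in> E. u \<in> g e} = 1" "card {e \<in> E. g e = {u}} = 0" using d deg[of u] by auto
    then obtain e where e: "{e \<in> E. u \<in> g e} = {e}" "{e \<in> E. g e = {u}} = {}"
      using fin by (auto simp: card_1_singleton_iff)
    then have "e \<in> E" "u \<in> g e" by auto
    moreover have "g e \<noteq> {u}" using e(2) \<open>e \<in> E\<close> by auto
    ultimately show ?thesis using nonloop e(1) by blast
  qed
  have two: "(\<exists>e. {e \<in> E. u \<in> g e} = {e} \<and> g e = {u}) \<or> (\<exists>e4 a4 e5 a5. two_edges_at g E u e4 a4 e5 a5)"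
    if d: "card {e \<in> E. u \<in> g e} + card {e \<in> E. g e = {u}} = 2" for u
  proof (cases "{e \<in> E. g e = {u}} = {}")
    case True
    then have "card {e \<in> E. u \<in> g e} = 2" using d unfolding True by simp
    then obtain e4 e5 where e: "{e \<in> E. u \<in> g e} = {e4, e5}" "e4 \<noteq> e5" by (auto simp: card_2_iff)
    then have "e4 \<in> E" "u \<in> g e4" "e5 \<in> E" "u \<in> g e5" by auto
    moreover from this have "g e4 \<noteq> {u}" "g e5 \<noteq> {u}" using True by auto
    ultimately show ?thesis using nonloop[of e4 u] nonloop[of e5 u] e unfolding two_edges_at_def by blast
  next
    case False
    then have "card {e \<in> E. g e = {u}} \<noteq> 0" using fin by auto
    then have c: "card {e \<in> E. u \<in> g e} = 1" "card {e \<in> E. g e = {u}} = 1" using d deg[of u] by auto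
    then obtain e where e: "{e \<in> E. u \<in> g e} = {e}" by (auto simp: card_1_singleton_iff)
    obtain e' where e': "e' \<in> E" "g e' = {u}" using False by auto
    then have "e' \<in> {e}" unfolding e[symmetric] by auto
    then show ?thesis using e e' by auto
  qed
  have dvd: "[zero_count q g V E a b y = zero_count q g V E a b x] (mod q)"
    if "q dvd zero_count q g V E a b y" "q dvd zero_count q g V E a b x"
    using that by (simp add: cong_iff_dvd_diff)
  consider "x = a \<or> y = a" | "x = b \<or> y = b" | "x \<noteq> a" "y \<noteq> a" "x \<noteq> b" "y \<noteq> b" by blast
  then show ?thesis
  proof cases
    case 1
    then have "card {e \<in> E. a \<in> g e} + card {e \<in> E. g e = {a}} = 1" using da xy(3) by auto
    then obtain e u' where "{e \<in> E. a \<in> g e} = {e}" "g e = {a, u'}" "u' \<noteq> a" using leaf by blast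
    from zero_count_leaf[OF assms(1) G ab xy(2) this] zero_count_leaf[OF assms(1) G ab xy(1) this]
    show ?thesis by (rule dvd)
  next
    case 2
    then have "card {e \<in> E. b \<in> g e} + card {e \<in> E. g e = {b}} = 1" using db xy(3) by auto
    then obtain e u' where "{e \<in> E. b \<in> g e} = {e}" "g e = {b, u'}" "u' \<noteq> b" using leaf by blast
    from zero_count_leaf[OF assms(1) G ab(2,1) ab(3)[symmetric] xy(2) this]
      zero_count_leaf[OF assms(1) G ab(2,1) ab(3)[symmetric] xy(1) this]
    show ?thesis unfolding zero_count_commute[of q g V E b a] by (rule dvd)
  next
    case 3
    have A: "card {e \<in> E. a \<in> g e} + card {e \<in> E. g e = {a}} = 2"
      and B: "card {e \<in> E. b \<in> g e} + card {e \<in> E. g e = {b}} = 2"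
      using da db 3 by auto
    show ?thesis
    proof (cases "\<exists>e. {e \<in> E. a \<in> g e} = {e} \<and> g e = {a}")
      case True
      then show ?thesis using zero_count_loop[OF G ab xy(1,2) 3(1,2), where q = q] by fastforce
    next
      case na: False
      show ?thesis
      proof (cases "\<exists>e. {e \<in> E. b \<in> g e} = {e} \<and> g e = {b}")
        case True
        then show ?thesis
          using zero_count_loop[OF G ab(2,1) ab(3)[symmetric] xy(1,2) 3(3,4), where q = q]
          unfolding zero_count_commute[of q g V E b a] by fastforce
      next
        case False
        obtain e4 a4 e5 a5 f4 b4 f5 b5 where t: "two_edges_at g E a e4 a4 e5 a5" "two_edges_at g E b f4 b4 f5 b5"
          using two[OF A] two[OF B] na False by blast
        have s: "[zero_count q g V E a b z = - split_count q g V E a b z] (mod q)"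
          if "z \<in> V" "z \<noteq> a" "z \<noteq> b" for z
          using zero_count_split[OF assms(1) G ab t that] .
        have "[- split_count q g V E a b y = - split_count q g V E a b x] (mod q)"
          unfolding cong_minus_minus_iff
          by (rule split_count_cong[OF assms(1) G ab t xy(2) 3(2,4) xy(1) 3(1,3)])
        then show ?thesis
          using cong_trans[OF s[OF xy(2) 3(2,4)]] cong_sym[OF s[OF xy(1) 3(1,3)]] cong_trans by blast
      qed
    qed
  qed
qed

section \<open>Point counts of vertex-deleted graphs\<close>

text \<open>Rooting the spanning trees at an arbitrary vertex, later the centre of the star, turns
  the Kirchhoff polynomial into a forest sum.\<close>

lemma kirchhoff_eq_root_sum:
  assumes "graph_on (ends H) (verts H) (edges H)" "r \<in> verts H"
  shows "kirchhoff H \<alpha> = root_sum (ends H) (verts H) [r] (edges H) \<alpha>"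
proof -
  have fin: "finite (edges H)" using assms by (simp add: graph_on_def)
  have t: "is_tree (H\<lparr>edges := T\<rparr>) \<longleftrightarrow> rooted_forest (ends H) (verts H) [r] T" if "T \<subseteq> edges H" for T
  proof -
    have "wf_graph (H\<lparr>edges := T\<rparr>)"
      using assms(1) that finite_subset[OF that fin] unfolding graph_on_def wf_graph_def by auto
    then show ?thesis using is_tree_iff[of "H\<lparr>edges := T\<rparr>" r] assms(2) by simp
  qed
  have "kirchhoff H \<alpha> = (\<Sum>T\<in>{T \<in> Pow (edges H). is_tree (H\<lparr>edges := T\<rparr>)}. \<Prod>e\<in>edges H - T. \<alpha> e)"
    unfolding kirchhoff_def spanning_trees_def by (intro sum.cong) auto
  also have "\<dots> = (\<Sum>T\<in>Pow (edges H). if is_tree (H\<lparr>edges := T\<rparr>) then \<Prod>e\<in>edges H - T. \<alpha> e else 0)"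
    using fin by (intro sum.inter_filter) auto
  also have "\<dots> = root_sum (ends H) (verts H) [r] (edges H) \<alpha>"
    unfolding root_sum_def edge_sum_def using t by (intro sum.cong) auto
  finally show ?thesis .
qed

lemma point_count_eq_sum:
  assumes "graph_on (ends H) (verts H) (edges H)" "r \<in> verts H"
  shows "int (point_count p H) = (\<Sum>\<alpha>\<in>edges H \<rightarrow>\<^sub>E {0..<int p}.
    zero_mod (int p) (root_sum (ends H) (verts H) [r] (edges H) \<alpha>))"
proof -
  have "finite (edges H \<rightarrow>\<^sub>E {0..<int p})" using assms by (auto simp: graph_on_def intro: finite_PiE)
  then show ?thesis
    unfolding point_count_def zero_mod_def kirchhoff_eq_root_sum[OF assms] cong_0_iff
    by (simp only: sum_of_bool_eq Int_def mem_Collect_eq)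
qed

lemma root_sum_star2:
  assumes G: "graph_on g V E" and w: "w \<notin> V" and V: "a \<in> V" "b \<in> V"
    and e: "g e1 = {w, a}" "g e2 = {w, b}" "e1 \<noteq> e2"
  shows "root_sum g (insert w V) [w] (insert e2 (insert e1 E)) \<alpha> =
    (\<alpha> e1 + \<alpha> e2) * root_sum g V [a] E \<alpha> + root_sum g V [a, b] E \<alpha>"
proof -
  have iso: "w \<notin> g d" if "d \<in> E" for d using G w that unfolding graph_on_def by fastforce
  have iso': "d \<in> F \<Longrightarrow> w \<notin> g d" if "F \<subseteq> E" for F d using iso that by blast
  have fin: "finite E" using G by (simp add: graph_on_def)
  have nE: "e2 \<notin> E" "e1 \<notin> E" using iso e by blast+
  have "edge_sum E (\<lambda>F. of_bool (rooted_forest g (insert w V) [w] F)) \<alpha> = edge_sum E (\<lambda>F. 0) \<alpha>"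
  proof (intro edge_sum_cong)
    fix F assume F: "F \<subseteq> E"
    have "rooted_forest g (insert w V) [w] F \<longleftrightarrow> rooted_forest g V [] F"
      using rooted_forest_isolated(2)[of F w g "[]" V] iso'[OF F] w by simp
    then show "of_bool (rooted_forest g (insert w V) [w] F) = (0 :: int)"
      using V by (auto simp: rooted_forest_def)
  qed
  moreover have P: "edge_sum E (\<lambda>F. of_bool (rooted_forest g (insert w V) [w] (insert d F))) \<alpha> = root_sum g V [a] E \<alpha>"
    if d: "g d = {w, u}" "u \<in> V" for d u
  proof -
    have "edge_sum E (\<lambda>F. of_bool (rooted_forest g (insert w V) [w] (insert d F))) \<alpha> = root_sum g V [u] E \<alpha>"
      unfolding root_sum_def
      by (intro edge_sum_cong arg_cong[of _ _ of_bool] rooted_forest_pendant(2)[of _ w g d u, OF iso' d w]) auto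
    then show ?thesis using root_sum_single_cong[OF d(2) V(1)] by simp
  qed
  moreover have "edge_sum E (\<lambda>F. of_bool (rooted_forest g (insert w V) [w] (insert e2 (insert e1 F)))) \<alpha> = root_sum g V [a, b] E \<alpha>"
    unfolding root_sum_def
    by (intro edge_sum_cong arg_cong[of _ _ of_bool]
        rooted_forest_star2[of _ w g e2 b e1 a, OF iso' e(2,1) e(3)[symmetric] V(2,1) w])
  ultimately show ?thesis
    unfolding root_sum_def[of g "insert w V"] edge_sum_insert2[OF fin nE e(3)[symmetric]]
      P[OF e(1) V(1)] P[OF e(2) V(2)]
    by (simp add: algebra_simps)
qed

text \<open>Each set of edges at \<open>w\<close> yields one coefficient: the empty set would
  isolate \<open>w\<close>, one edge makes \<open>w\<close> a leaf, and two or three edges leave a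
  2-forest or 3-forest after \<open>w\<close> is deleted.\<close>

lemma root_sum_star3:
  assumes G: "graph_on g V E" and w: "w \<notin> V" and V: "a \<in> V" "b \<in> V" "y \<in> V"
    and e: "g e1 = {w, a}" "g e2 = {w, b}" "g e3 = {w, y}" "e1 \<noteq> e2" "e1 \<noteq> e3" "e2 \<noteq> e3"
  shows "root_sum g (insert w V) [w] (insert e3 (insert e2 (insert e1 E))) \<alpha> =
    root_sum g V [y] E \<alpha> * (\<alpha> e2 * \<alpha> e3 + \<alpha> e1 * \<alpha> e3 + \<alpha> e1 * \<alpha> e2) +
    root_sum g V [b, y] E \<alpha> * \<alpha> e1 + root_sum g V [a, y] E \<alpha> * \<alpha> e2 +
    root_sum g V [a, b] E \<alpha> * \<alpha> e3 + root_sum g V [b, a, y] E \<alpha>"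
proof -
  have iso: "w \<notin> g d" if "d \<in> E" for d using G w that unfolding graph_on_def by fastforce
  have iso': "d \<in> F \<Longrightarrow> w \<notin> g d" if "F \<subseteq> E" for F d using iso that by blast
  have fin: "finite E" "finite (insert e2 (insert e1 E))" using G by (simp_all add: graph_on_def)
  have nE: "e2 \<notin> E" "e1 \<notin> E" "e3 \<notin> insert e2 (insert e1 E)" using iso e by blast+
  let ?w = "\<lambda>F. of_bool (rooted_forest g (insert w V) [w] F) :: int"
  have 1: "edge_sum (insert e2 (insert e1 E)) ?w \<alpha> =
    (\<alpha> e1 + \<alpha> e2) * root_sum g V [y] E \<alpha> + root_sum g V [a, b] E \<alpha>"
    using root_sum_star2[of g V E w a b e1 e2 \<alpha>, OF G w V(1,2) e(1,2,4)] root_sum_single_cong[OF V(1,3), of g E \<alpha>]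
    unfolding root_sum_def[of g "insert w V"] by simp
  have P: "edge_sum E (\<lambda>F. ?w (insert e3 F)) \<alpha> = root_sum g V [y] E \<alpha>"
    unfolding root_sum_def
    by (intro edge_sum_cong arg_cong[of _ _ of_bool] rooted_forest_pendant(2)[of _ w g e3 y, OF iso' e(3) V(3) w]) auto
  have 31: "edge_sum E (\<lambda>F. ?w (insert e3 (insert e1 F))) \<alpha> = root_sum g V [a, y] E \<alpha>"
    unfolding root_sum_def
    by (intro edge_sum_cong arg_cong[of _ _ of_bool]
        rooted_forest_star2[of _ w g e3 y e1 a, OF iso' e(3,1) e(5)[symmetric] V(3,1) w])
  have 32: "edge_sum E (\<lambda>F. ?w (insert e3 (insert e2 F))) \<alpha> = root_sum g V [b, y] E \<alpha>"
    unfolding root_sum_def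
    by (intro edge_sum_cong arg_cong[of _ _ of_bool]
        rooted_forest_star2[of _ w g e3 y e2 b, OF iso' e(3,2) e(6)[symmetric] V(3,2) w])
  have 321: "edge_sum E (\<lambda>F. ?w (insert e3 (insert e2 (insert e1 F)))) \<alpha> = root_sum g V [b, a, y] E \<alpha>"
    unfolding root_sum_def
  proof (intro edge_sum_cong arg_cong[of _ _ of_bool])
    fix F assume F: "F \<subseteq> E"
    show "rooted_forest g (insert w V) [w] (insert e3 (insert e2 (insert e1 F))) = rooted_forest g V [b, a, y] F"
      using rooted_forest_star3[of F w g e1 a e2 b e3 y V, OF iso'[OF F] e V w]
      by (simp add: insert_commute)
  qed
  have 2: "edge_sum (insert e2 (insert e1 E)) (\<lambda>F. ?w (insert e3 F)) \<alpha> =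
    \<alpha> e2 * \<alpha> e1 * root_sum g V [y] E \<alpha> + \<alpha> e1 * root_sum g V [b, y] E \<alpha> +
    \<alpha> e2 * root_sum g V [a, y] E \<alpha> + root_sum g V [b, a, y] E \<alpha>"
    unfolding edge_sum_insert2[OF fin(1) nE(1,2) e(4)[symmetric]] P 31 32 321 ..
  show ?thesis
    unfolding root_sum_def[of g "insert w V"] edge_sum_insert[OF fin(2) nE(3)] 1 2
    by (simp add: algebra_simps)
qed

lemma graph_on_insert:
  assumes "graph_on g V E" "g e = {w, u}" "u \<in> V"
  shows "graph_on g (insert w V) (insert e E)"
proof -
  have "\<exists>x\<in>insert w V. \<exists>y\<in>insert w V. g d = {x, y}" if "d \<in> E" for d
    using assms(1) that unfolding graph_on_def by (meson insertCI)
  moreover have "\<exists>x\<in>insert w V. \<exists>y\<in>insert w V. g e = {x, y}" using assms(2,3) by blast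
  ultimately show ?thesis using assms(1) unfolding graph_on_def by auto
qed

text \<open>Serves for a double edge between \<open>v\<close> and \<open>w\<close>. The right-hand
  side refers neither to the centre nor to its edges, so it is the same for both deleted
  graphs.\<close>

lemma point_count_star2:
  assumes G: "graph_on g V E" and w: "w \<notin> V" and V: "a \<in> V" "b \<in> V"
    and e: "g e1 = {w, a}" "g e2 = {w, b}" "e1 \<noteq> e2"
    and H: "ends H = g" "verts H = insert w V" "edges H = insert e2 (insert e1 E)"
  shows "int (point_count p H) = (\<Sum>\<alpha>\<in>E \<rightarrow>\<^sub>E {0..<int p}. \<Sum>x\<in>{0..<int p}. \<Sum>y\<in>{0..<int p}.
    zero_mod (int p) ((x + y) * root_sum g V [a] E \<alpha> + root_sum g V [a, b] E \<alpha>))"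
proof -
  have nE: "e1 \<notin> E" "e2 \<notin> E" "e2 \<notin> insert e1 E"
    using G w e unfolding graph_on_def by (metis insert_iff doubleton_eq_iff)+
  have GH: "graph_on (ends H) (verts H) (edges H)"
    using graph_on_insert[of g "insert w V" _ e2 w b, OF graph_on_insert[of g V E e1 w a, OF G e(1) V(1)] e(2)] V
    unfolding H by simp
  have "int (point_count p H) = (\<Sum>\<alpha>\<in>insert e2 (insert e1 E) \<rightarrow>\<^sub>E {0..<int p}.
      zero_mod (int p) ((\<alpha> e1 + \<alpha> e2) * root_sum g V [a] E \<alpha> + root_sum g V [a, b] E \<alpha>))"
    using point_count_eq_sum[OF GH, of w p] root_sum_star2[of g V E w a b e1 e2, OF G w V e] unfolding H by simp
  then show ?thesis
    unfolding sum_PiE_insert[OF nE(3)] sum_PiE_insert[OF nE(1)] using nE e(3) by simp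
qed

text \<open>The term \<open>k\<close> collects the points where the constant of the cone vanishes as
  well; it disappears modulo \<open>p\<close> after division by \<open>p^2\<close>.\<close>

lemma point_count_star3:
  assumes G: "graph_on g V E" and w: "w \<notin> V" and V: "a \<in> V" "b \<in> V" "y \<in> V"
    and e: "g e1 = {w, a}" "g e2 = {w, b}" "g e3 = {w, y}" "e1 \<noteq> e2" "e1 \<noteq> e3" "e2 \<noteq> e3"
    and H: "ends H = g" "verts H = insert w V" "edges H = insert e3 (insert e2 (insert e1 E))"
    and p: "prime p"
  obtains k where "int (point_count p H) =
    (int p)\<^sup>2 * (int p ^ card E - zero_count (int p) g V E a b y + int p * k)"
proof -
  define q where "q = int p"
  have q: "prime q" using p by (simp add: q_def)
  have q0: "q > 0" using prime_gt_0_int[OF q] .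
  have nE: "e1 \<notin> E" "e2 \<notin> E" "e3 \<notin> E" "e2 \<notin> insert e1 E" "e3 \<notin> insert e2 (insert e1 E)"
    using G w e unfolding graph_on_def by (metis insert_iff doubleton_eq_iff)+
  have fin: "finite E" "finite V" "\<And>d. d \<in> E \<Longrightarrow> \<exists>x\<in>V. \<exists>y\<in>V. g d = {x, y}"
    using G by (auto simp: graph_on_def)
  have GH: "graph_on (ends H) (verts H) (edges H)"
    using graph_on_insert[of g "insert w V" _ e3 w y, OF _ e(3)]
      graph_on_insert[of g "insert w V" _ e2 w b, OF _ e(2)] graph_on_insert[of g V E e1 w a, OF G e(1) V(1)] V
    unfolding H by simp
  let ?T = "root_sum g V [y] E" and ?f13 = "root_sum g V [a, y] E" and ?f23 = "root_sum g V [b, y] E"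
    and ?f3 = "split_sum g V a y b E" and ?f = "root_sum g V [b, a, y] E"
  have cone: "(\<Sum>x\<in>{0..<q}. \<Sum>y'\<in>{0..<q}. \<Sum>z\<in>{0..<q}.
      zero_mod q (?T \<alpha> * (y' * z + x * z + x * y') + ?f23 \<alpha> * x + ?f13 \<alpha> * y' + (?f13 \<alpha> + ?f23 \<alpha> - 2 * ?f3 \<alpha>) * z + ?f \<alpha>)) =
    q\<^sup>2 * (1 - zero_mod q (?T \<alpha>) * zero_mod q (?f13 \<alpha>) * zero_mod q (?f23 \<alpha>) * (1 - q * zero_mod q (?f \<alpha>)))" for \<alpha>
    unfolding q_def root_sum_def split_sum_def
    by (rule sum_cone_zeros[OF q[unfolded q_def] edge_sum_identity[of E V g a b y p \<alpha>, OF fin V prime_gt_0_nat[OF p]]])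
  have "int (point_count p H) = (\<Sum>\<alpha>\<in>insert e3 (insert e2 (insert e1 E)) \<rightarrow>\<^sub>E {0..<q}.
      zero_mod q (?T \<alpha> * (\<alpha> e2 * \<alpha> e3 + \<alpha> e1 * \<alpha> e3 + \<alpha> e1 * \<alpha> e2) + ?f23 \<alpha> * \<alpha> e1 + ?f13 \<alpha> * \<alpha> e2 +
        (?f13 \<alpha> + ?f23 \<alpha> - 2 * ?f3 \<alpha>) * \<alpha> e3 + ?f \<alpha>))"
    using point_count_eq_sum[OF GH, of w p] root_sum_star3[of g V E w a b y e1 e2 e3, OF G w V e]
      root_sum_two_roots[OF V, of g E]
    unfolding H q_def by simp
  also have "\<dots> = (\<Sum>\<alpha>\<in>E \<rightarrow>\<^sub>E {0..<q}. \<Sum>x\<in>{0..<q}. \<Sum>y'\<in>{0..<q}. \<Sum>z\<in>{0..<q}.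
      zero_mod q (?T \<alpha> * (y' * z + x * z + x * y') + ?f23 \<alpha> * x + ?f13 \<alpha> * y' + (?f13 \<alpha> + ?f23 \<alpha> - 2 * ?f3 \<alpha>) * z + ?f \<alpha>))"
    unfolding sum_PiE_insert[OF nE(5)] sum_PiE_insert[OF nE(4)] sum_PiE_insert[OF nE(1)]
    using nE e(4-6) by simp
  also have "\<dots> = (\<Sum>\<alpha>\<in>E \<rightarrow>\<^sub>E {0..<q}. q\<^sup>2 * (1 - zero_mod q (?T \<alpha>) * zero_mod q (?f13 \<alpha>) * zero_mod q (?f23 \<alpha>) +
      q * (zero_mod q (?T \<alpha>) * zero_mod q (?f13 \<alpha>) * zero_mod q (?f23 \<alpha>) * zero_mod q (?f \<alpha>))))"
    unfolding cone by (intro sum.cong refl) (simp add: algebra_simps)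
  also have "\<dots> = q\<^sup>2 * (q ^ card E - zero_count q g V E a b y +
      q * (\<Sum>\<alpha>\<in>E \<rightarrow>\<^sub>E {0..<q}. zero_mod q (?T \<alpha>) * zero_mod q (?f13 \<alpha>) * zero_mod q (?f23 \<alpha>) * zero_mod q (?f \<alpha>)))"
    unfolding zero_count_def sum_distrib_left[symmetric] sum.distrib sum_subtractf
    using q0 by (simp add: card_PiE[OF fin(1)])
  finally show ?thesis using that unfolding q_def by blast
qed

section \<open>The neighbourhood of the two deleted vertices\<close>

lemma four_edges:
  assumes G: "wf_graph G" "degree G v = 4"
    and d: "d0 \<in> edges G" "d1 \<in> edges G" "d2 \<in> edges G" "d0 \<noteq> d1" "d0 \<noteq> d2" "d1 \<noteq> d2"
      "v \<in> ends G d0" "v \<in> ends G d1" "v \<in> ends G d2"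
      "ends G d0 \<noteq> {v}" "ends G d1 \<noteq> {v}" "ends G d2 \<noteq> {v}"
  obtains d3 x where "{e \<in> edges G. v \<in> ends G e} = {d0, d1, d2, d3}" "d3 \<notin> {d0, d1, d2}"
    "ends G d3 = {v, x}" "x \<noteq> v" "x \<in> verts G"
proof -
  let ?A = "{e \<in> edges G. v \<in> ends G e}" and ?L = "{e \<in> edges G. ends G e = {v}}"
  have fin: "finite ?A" "finite ?L" using G(1) by (auto simp: wf_graph_def)
  have c: "card ?A + card ?L = 4" using G(2) by (simp add: degree_def)
  have three: "card {d0, d1, d2} = 3" using d by simp
  \<comment> \<open>A loop counts twice in the degree, so next to three other edges there is no room
    for one in degree 4.\<close>
  have "card ({d0, d1, d2} \<union> ?L) = 3 + card ?L"
    using three fin d by (subst card_Un_disjoint) auto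
  moreover have "card ({d0, d1, d2} \<union> ?L) \<le> card ?A" using fin d by (intro card_mono) auto
  ultimately have L: "card ?L = 0" and A: "card ?A = 4" using c by auto
  have sub: "{d0, d1, d2} \<subseteq> ?A" using d by auto
  have "card (?A - {d0, d1, d2}) = 1" using A three sub by (subst card_Diff_subset) auto
  then obtain d3 where d3: "?A - {d0, d1, d2} = {d3}" by (auto simp: card_1_singleton_iff)
  have d3': "d3 \<in> edges G" "v \<in> ends G d3" "d3 \<notin> {d0, d1, d2}" using d3 by auto
  have "ends G d3 \<noteq> {v}" using L fin d3' by auto
  moreover obtain s t where st: "ends G d3 = {s, t}" "s \<in> verts G" "t \<in> verts G"
    using G(1) d3'(1) unfolding wf_graph_def by blast
  ultimately obtain x where x: "ends G d3 = {v, x}" "x \<noteq> v" "x \<in> verts G"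
    using d3'(2) by (auto simp: insert_commute)
  have "?A = {d0, d1, d2, d3}" using d3 sub by auto
  then show ?thesis using that x d3'(3) by blast
qed

lemma c2_at_eqI:
  assumes "int (point_count p G) = (int p)\<^sup>2 * m" "int (point_count p H) = (int p)\<^sup>2 * n"
    and "[m = n] (mod int p)" "prime p"
  shows "c2_at p G = c2_at p H"
proof -
  have p0: "(int p)\<^sup>2 \<noteq> 0" using prime_gt_0_nat[OF assms(4)] by simp
  have "int (c2_at p G) = m mod int p" "int (c2_at p H) = n mod int p"
    using p0 unfolding c2_at_def of_nat_mod of_nat_div of_nat_power assms(1,2) by simp_all
  then show ?thesis using assms(3) by (simp add: cong_def)
qed

lemma c2_at_delete_vertex:
  assumes wf: "wf_graph G" and reg: "regular_graph 4 G" and p: "prime p"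
    and v: "v \<in> verts G" and w: "w \<in> verts G" and vw: "w \<in> neighbours G v"
    and two: "card (neighbours G v \<inter> neighbours G w) = 2"
  shows "c2_at p (delete_vertex G v) = c2_at p (delete_vertex G w)"
proof -
  let ?g = "ends G"
  have deg: "degree G u = 4" if "u \<in> verts G" for u using reg that by (simp add: regular_graph_def)
  obtain a b where ab: "neighbours G v \<inter> neighbours G w = {a, b}" "a \<noteq> b"
    using two by (auto simp: card_2_iff)
  then have nb: "a \<in> neighbours G v" "a \<in> neighbours G w" "b \<in> neighbours G v" "b \<in> neighbours G w" by auto
  then have n: "a \<noteq> v" "a \<noteq> w" "b \<noteq> v" "b \<noteq> w" "w \<noteq> v" using vw by (auto simp: neighbours_def)
  obtain d0 where d0: "d0 \<in> edges G" "?g d0 = {v, w}" using vw by (auto simp: neighbours_def)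
  obtain d1 where d1: "d1 \<in> edges G" "?g d1 = {v, a}" using nb by (auto simp: neighbours_def)
  obtain d2 where d2: "d2 \<in> edges G" "?g d2 = {v, b}" using nb by (auto simp: neighbours_def)
  obtain c1 where c1: "c1 \<in> edges G" "?g c1 = {w, a}" using nb by (auto simp: neighbours_def)
  obtain c2 where c2: "c2 \<in> edges G" "?g c2 = {w, b}" using nb by (auto simp: neighbours_def)
  have nd: "d0 \<noteq> d1" "d0 \<noteq> d2" "d1 \<noteq> d2" using d0 d1 d2 n ab(2) by (auto simp: doubleton_eq_iff)
  have nc: "d0 \<noteq> c1" "d0 \<noteq> c2" "c1 \<noteq> c2" using d0 c1 c2 n ab(2) by (auto simp: doubleton_eq_iff)
  \<comment> \<open>Besides one edge to each of \<open>w\<close>, \<open>a\<close> and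
    \<open>b\<close> there is exactly one further edge at \<open>v\<close>, and likewise at
    \<open>w\<close>; its far end may be any of the vertices already named.\<close>
  obtain d3 x where d3: "{e \<in> edges G. v \<in> ?g e} = {d0, d1, d2, d3}" "d3 \<notin> {d0, d1, d2}"
    "?g d3 = {v, x}" "x \<noteq> v" "x \<in> verts G"
    by (rule four_edges[OF wf deg[OF v], of d0 d1 d2]) (use d0 d1 d2 nd n in auto)
  obtain c3 y where c3: "{e \<in> edges G. w \<in> ?g e} = {d0, c1, c2, c3}" "c3 \<notin> {d0, c1, c2}"
    "?g c3 = {w, y}" "y \<noteq> w" "y \<in> verts G"
    by (rule four_edges[OF wf deg[OF w], of d0 c1 c2]) (use d0 c1 c2 nc n in auto)
  have e3: "d3 \<in> edges G" "c3 \<in> edges G" using d3(1) c3(1) by auto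
  define V where "V = verts G - {v, w}"
  define E where "E = {e \<in> edges G. v \<notin> ?g e \<and> w \<notin> ?g e}"
  have ends: "s \<in> verts G" "t \<in> verts G" if "e \<in> edges G" "?g e = {s, t}" for e s t
    using wf that unfolding wf_graph_def by (metis doubleton_eq_iff)+
  have GK: "graph_on ?g V E"
  proof -
    have "\<exists>s\<in>V. \<exists>t\<in>V. ?g e = {s, t}" if e: "e \<in> E" for e
    proof -
      obtain s t where st: "?g e = {s, t}" "s \<in> verts G" "t \<in> verts G"
        using wf e unfolding wf_graph_def E_def by blast
      then have "s \<in> V" "t \<in> V" using e by (auto simp: E_def V_def)
      then show ?thesis using st(1) by blast
    qed
    then show ?thesis using wf unfolding graph_on_def wf_graph_def E_def V_def by simp
  qed
  have V: "a \<in> V" "b \<in> V" "w \<notin> V" "v \<notin> V"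
    using ends(2)[OF d1] ends(2)[OF d2] n by (auto simp: V_def)
  have Hv: "ends (delete_vertex G v) = ?g" "verts (delete_vertex G v) = insert w V"
      "edges (delete_vertex G v) = E \<union> {e \<in> {d0, c1, c2, c3}. v \<notin> ?g e}"
    and Hw: "ends (delete_vertex G w) = ?g" "verts (delete_vertex G w) = insert v V"
      "edges (delete_vertex G w) = E \<union> {e \<in> {d0, d1, d2, d3}. w \<notin> ?g e}"
    unfolding c3(1)[symmetric] d3(1)[symmetric] using v w n(5)
    by (auto simp: delete_vertex_def V_def E_def)
  have c12: "v \<notin> ?g c1" "v \<notin> ?g c2" "w \<notin> ?g d1" "w \<notin> ?g d2" "v \<in> ?g d0" "w \<in> ?g d0"
    using c1 c2 d0 d1 d2 n by auto
  show ?thesis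
  proof (cases "x = w")
    \<comment> \<open>The fourth edge at \<open>v\<close> is a second edge to \<open>w\<close>,
      hence also the fourth edge at \<open>w\<close>. Both deleted graphs then have only
      \<open>a\<close> and \<open>b\<close> as neighbours of the remaining vertex.\<close>
    case True
    then have "d3 \<in> {d0, c1, c2, c3}" unfolding c3(1)[symmetric] using e3 d3(3) by auto
    then have "d3 = c3" using d3(2,3) c12 by auto
    then have "v \<in> ?g c3" "w \<in> ?g d3" using d3(3) True by auto
    then have "edges (delete_vertex G v) = insert c2 (insert c1 E)"
      "edges (delete_vertex G w) = insert d2 (insert d1 E)"
      using Hv(3) Hw(3) c12 by auto
    then have "int (point_count p (delete_vertex G v)) = int (point_count p (delete_vertex G w))"
      using point_count_star2[OF GK V(3,1,2) c1(2) c2(2) nc(3) Hv(1,2)]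
        point_count_star2[OF GK V(4,1,2) d1(2) d2(2) nd(3) Hw(1,2)] by simp
    then show ?thesis by (simp add: c2_at_def)
  next
    case xw: False
    have yv: "y \<noteq> v"
    proof
      assume "y = v"
      then have "c3 \<in> {d0, d1, d2, d3}" unfolding d3(1)[symmetric] using e3 c3(3) by auto
      then have "c3 = d3" using c3(2,3) c12 by auto
      then show False using c3(3) d3(3) xw n(5) by auto
    qed
    have xy: "x \<in> V" "y \<in> V" using xw yv d3 c3 by (auto simp: V_def)
    have c3v: "v \<notin> ?g c3" "w \<notin> ?g d3" using c3(3) d3(3,4) xw yv n(5) by auto
    have E: "edges (delete_vertex G v) = insert c3 (insert c2 (insert c1 E))"
      "edges (delete_vertex G w) = insert d3 (insert d2 (insert d1 E))"
      using Hv(3) Hw(3) c12 c3v by auto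
    have m: "c1 \<noteq> c3" "c2 \<noteq> c3" "d1 \<noteq> d3" "d2 \<noteq> d3" using c3(2) d3(2) by auto
    \<comment> \<open>A common neighbour \<open>u\<close> loses its edges to \<open>v\<close> and
      \<open>w\<close>, and in addition a fourth edge that ends at it; loops at \<open>u\<close>
      survive. The parameters allow \<open>a\<close> and \<open>b\<close> to exchange their
      roles.\<close>
    have degK: "card {e \<in> E. u \<in> ?g e} + card {e \<in> E. ?g e = {u}} + of_bool (x = u) + of_bool (y = u) = 2"
      if u: "u \<in> V" "{d1, d2} = {du, du'}" "?g du = {v, u}" "?g du' = {v, u'}"
        "{c1, c2} = {cu, cu'}" "?g cu = {w, u}" "?g cu' = {w, u'}" "u' \<noteq> u" for u u' du du' cu cu'
    proof -
      have un: "u \<noteq> v" "u \<noteq> w" "u \<in> verts G" using u(1) by (auto simp: V_def)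
      define X where "X = {du, cu} \<union> (if x = u then {d3} else {}) \<union> (if y = u then {c3} else {})"
      have inX: "e \<in> X \<longleftrightarrow> e \<in> {d0, d1, d2, d3} \<union> {d0, c1, c2, c3} \<and> u \<in> ?g e" for e
      proof -
        have "{d0, d1, d2, d3} \<union> {d0, c1, c2, c3} = {d0, du, du', d3, cu, cu', c3}"
          using u(2,5) by auto
        then show ?thesis unfolding X_def using u(3,4,6,7,8) un d0(2) d3(3) c3(3) by auto
      qed
      have X: "{e \<in> edges G. u \<in> ?g e} = {e \<in> E. u \<in> ?g e} \<union> X"
      proof (intro set_eqI)
        fix e
        have "e \<in> X \<longleftrightarrow> e \<in> edges G \<and> (v \<in> ?g e \<or> w \<in> ?g e) \<and> u \<in> ?g e"
          unfolding inX d3(1)[symmetric] c3(1)[symmetric] by auto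
        then show "e \<in> {e \<in> edges G. u \<in> ?g e} \<longleftrightarrow> e \<in> {e \<in> E. u \<in> ?g e} \<union> X"
          by (auto simp: E_def)
      qed
      have disj: "{e \<in> E. u \<in> ?g e} \<inter> X = {}"
        unfolding inX[abs_def] using inX d3(1) c3(1) by (auto simp: E_def)
      have dist: "du \<noteq> cu" "du \<noteq> d3" "du \<noteq> c3" "cu \<noteq> d3" "cu \<noteq> c3" "d3 \<noteq> c3"
      proof -
        have "du \<in> {d1, d2}" "cu \<in> {c1, c2}" using u(2,5) by auto
        then show "du \<noteq> d3" "cu \<noteq> c3" using m by auto
        show "du \<noteq> cu" "du \<noteq> c3" "cu \<noteq> d3" "d3 \<noteq> c3"
          using u(3,6) un n(5) c3v d3(3) c3(3) by auto
      qed
      have "card X = 2 + of_bool (x = u) + of_bool (y = u)"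
        unfolding X_def using dist by simp
      moreover have "finite X" "finite {e \<in> E. u \<in> ?g e}"
        using GK by (auto simp: X_def graph_on_def)
      ultimately have "card {e \<in> edges G. u \<in> ?g e} =
          card {e \<in> E. u \<in> ?g e} + (2 + of_bool (x = u) + of_bool (y = u))"
        unfolding X using disj by (simp add: card_Un_disjoint)
      moreover have "{e \<in> edges G. ?g e = {u}} = {e \<in> E. ?g e = {u}}" using un by (auto simp: E_def)
      ultimately show ?thesis using deg[OF un(3)] by (simp add: degree_def)
    qed
    have dab: "card {e \<in> E. a \<in> ?g e} + card {e \<in> E. ?g e = {a}} + of_bool (x = a) + of_bool (y = a) = 2"
      using degK[OF V(1) refl d1(2) d2(2) refl c1(2) c2(2) ab(2)[symmetric]] .
    have dba: "card {e \<in> E. b \<in> ?g e} + card {e \<in> E. ?g e = {b}} + of_bool (x = b) + of_bool (y = b) = 2"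
      using degK[OF V(2) insert_commute d2(2) d1(2) insert_commute c2(2) c1(2) ab(2)] .
    have q: "prime (int p)" using p by simp
    have zc: "[zero_count (int p) ?g V E a b y = zero_count (int p) ?g V E a b x] (mod int p)"
    proof (cases "x = y")
      case False
      then show ?thesis using zero_count_cong[OF q GK V(1,2) ab(2) xy _ dab dba] by blast
    qed simp
    obtain k where k: "int (point_count p (delete_vertex G v)) =
        (int p)\<^sup>2 * (int p ^ card E - zero_count (int p) ?g V E a b y + int p * k)"
      by (rule point_count_star3[OF GK V(3,1,2) xy(2) c1(2) c2(2) c3(3) nc(3) m(1,2) Hv(1,2) E(1) p])
    obtain l where l: "int (point_count p (delete_vertex G w)) =
        (int p)\<^sup>2 * (int p ^ card E - zero_count (int p) ?g V E a b x + int p * l)"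
      by (rule point_count_star3[OF GK V(4,1,2) xy(1) d1(2) d2(2) d3(3) nd(3) m(3,4) Hw(1,2) E(2) p])
    show ?thesis
      by (rule c2_at_eqI[OF k l _ p]) (intro cong_add cong_diff cong_refl zc, simp add: cong_def)
  qed
qed

theorem theorem7p10:
  fixes G :: "('v, 'e) multigraph" and v w :: 'v and p :: nat
  assumes "wf_graph G"
    and "connected_graph G"
    and "regular_graph 4 G"
    and "prime p"
    and "v \<in> verts G" and "w \<in> verts G"
    and "w \<in> neighbours G v"
    and "card (neighbours G v \<inter> neighbours G w) = 2"
  shows "c2_at p (delete_vertex G v) = c2_at p (delete_vertex G w) \<and>
         c2 (delete_vertex G v) = c2 (delete_vertex G w)"
  using c2_at_delete_vertex[OF assms(1,3) _ assms(5-8)] assms(4)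
  by (auto simp: c2_def restrict_def fun_eq_iff)

end
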